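(* Let $n\ge2$, $k\ge1$, let $\mathbf D_n\subset SU_2$ be the binary dihedral group of order $4n$, $V=\mathbb C^2$, and $Z_k(\mathbf D_n)=\mathrm{End}_{\mathbf D_n}(V^{\otimes k})$. Assume $\ell\in\Lambda_k^\bullet(\mathbf D_n)$, and let $a_\ell\in\{0,1,\dots,k\}$ be minimal such that $\ell\equiv k-2a_\ell\bmod 2n$. Let $\mathsf K_\ell=\{\mathsf r\in\{-1,1\}^k\mid k-2|\mathsf r|\equiv\ell\bmod 2n,\ \mathsf r\succ-\mathsf r\}$. (i) For $\ell\in\{1,\dots,n-1\}$, $Z_k^{(\ell)}=Z_k(\mathbf D_n)^{(\ell)}:=\mathrm{span}_{\mathbb C}\{v_{\mathsf t}\mid\mathsf t\in\mathsf K_\ell\}$ is an irreducible $Z_k(\mathbf D_n)$-module, and $$\dim Z_k^{(\ell)}=\sum_{\substack{0\le b\le k\\ b\equiv a_\ell\bmod n}}\binom kb=\text{coefficient of }z^{a_\ell}\text{ in }(1+z)^k\big|_{z^n=1}.$$ (ii) For $\ell\in\{0,n\}$, $$Z_k^{(\ell)}=Z_k(\mathbf D_n)^{(\ell)}:=\mathrm{span}_{\mathbb C}\{v_{\mathsf t}+i^{\ell-k}v_{-\mathsf t}\mid\mathsf t\in\mathsf K_\ell\},\qquad Z_k^{(\ell')}=Z_k(\mathbf D_n)^{(\ell')}:=\mathrm{span}_{\mathbb C}\{v_{\mathsf t}-i^{\ell-k}v_{-\mathsf t}\mid\mathsf t\in\mathsf K_\ell\}$$ are irreducible $Z_k(\mathbf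 D_n)$-modules, and $$\dim Z_k^{(\ell')}=\dim Z_k^{(\ell)}=\frac12\sum_{\substack{0\le b\le k\\ b\equiv a_\ell\bmod n}}\binom kb=\frac12\Big(\text{coefficient of }z^{a_\ell}\text{ in }(1+z)^k\big|_{z^n=1}\Big).$$ Up to isomorphism, the modules in (i) and (ii) are the only irreducible $Z_k(\mathbf D_n)$-modules.
   Context: $\mathbf D_n$ is generated by $g=\mathrm{diag}(\zeta^{-1},\zeta)$, $\zeta$ a primitive $2n$th root of unity, and $h=\begin{pmatrix}0&i\\i&0\end{pmatrix}$, $i=\sqrt{-1}$. $V=\mathbb C^2$ has basis $v_{-1}=(1,0)^t$, $v_1=(0,1)^t$; $\mathbf D_n$ acts diagonally on $V^{\otimes k}$. For $\mathsf r\in\{-1,1\}^k$: $v_{\mathsf r}=v_{r_1}\otimes\cdots\otimes v_{r_k}$, $-\mathsf r=(-r_1,\dots,-r_k)$, and $|\mathsf r|$ is the number of $j$ with $r_j=-1$. Order on $\{-1,1\}^k$: $\mathsf r\succeq\mathsf s$ if $|\mathsf r|\le|\mathsf s|$ and, in case $|\mathsf r|=|\mathsf s|$, $\mathsf r$ is greater than or equal to $\mathsf s$ in the lexicographic order coming from $1>-1$; $\succ$ is the strict version. $\Lambda_k^\bullet(\mathbf D_n)=\{\ell\in\{0,1,\dots,n\}\mid\ell\equiv k-2a\bmod 2n\text{ for some }a\in\{0,1,\dots,k\}\}$. $0'$ and $n'$ are additional labels attached to $0$ and $n$. $(1+z)^k|_{z^n=1}$ means the image in $\mathbb C[z]/(z^n-1)$,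 exponents read modulo $n$.
   Formalization: In K_ℓ the condition r ≻ −r is imposed only for ℓ ∈ {0,n}; for 1 ≤ ℓ ≤ n−1 it is dropped, since as printed (i) fails (n=2, k=3, ℓ=1: K_1 has 3 elements but the stated dimension is 4). *)

theory Defs
  imports
    "HOL-Analysis.Analysis"
    "HOL-Algebra.Generated_Groups"
    "HOL-Computational_Algebra.Polynomial"
    "HOL-Number_Theory.Cong"
    "HOL-Library.Fun_Lexorder"
begin

text \<open>
  The \<open>k\<close> tensor positions are the elements of a finite linearly ordered type \<open>'k\<close>, so
  \<open>k = CARD('k)\<close>; the linear order matters only for the lexicographic order on sign sequences.
  \<open>V\<close> is \<open>complex ^ 2\<close>, and \<open>V\<^sup>\<otimes>\<^sup>k\<close> is the space of coordinate arrays indexed by \<open>'k \<Rightarrow> 2\<close>.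
\<close>

type_synonym 'k tensor = "(complex, 'k \<Rightarrow> 2) vec"

definition pure_tensor :: "('k::finite \<Rightarrow> complex ^ 2) \<Rightarrow> 'k tensor" where
  "pure_tensor w = (\<chi> \<iota>. \<Prod>j\<in>UNIV. w j $ \<iota> j)"

definition tensor_power :: "complex ^ 2 ^ 2 \<Rightarrow> 'k::finite tensor \<Rightarrow> 'k tensor" where
  "tensor_power A = (*v) (\<chi> \<iota> \<kappa>. \<Prod>j\<in>UNIV. A $ \<iota> j $ \<kappa> j)"

lemma tensor_power_pure_tensor:
  "tensor_power A (pure_tensor w) = pure_tensor (\<lambda>j. A *v w j)"
proof -
  have "(\<Sum>\<kappa>\<in>UNIV. (\<Prod>j\<in>UNIV. A $ \<iota> j $ \<kappa> j) * (\<Prod>j\<in>UNIV. w j $ \<kappa> j)) =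
        (\<Prod>j\<in>UNIV. \<Sum>m\<in>UNIV. A $ \<iota> j $ m * w j $ m)" for \<iota> :: "'a \<Rightarrow> 2"
    by (subst prod_sum_PiE) (simp_all add: prod.distrib PiE_UNIV_domain)
  then show ?thesis
    by (simp add: vec_eq_iff tensor_power_def pure_tensor_def matrix_vector_mult_def)
qed


definition primitive_root_of_unity :: "nat \<Rightarrow> complex \<Rightarrow> bool" where
  "primitive_root_of_unity m z \<longleftrightarrow> z ^ m = 1 \<and> (\<forall>j. 0 < j \<and> j < m \<longrightarrow> z ^ j \<noteq> 1)"

definition SU2 :: "(complex ^ 2 ^ 2) monoid" where
  "SU2 = \<lparr>carrier = {A. A ** (\<chi> i j. cnj (A $ j $ i)) = mat 1 \<and> det A = 1},
          mult = (**), one = mat 1\<rparr>"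

text \<open>\<open>\<zeta>\<close> stands for a primitive \<open>2n\<close>th root of unity, which determines \<open>n\<close>.\<close>

definition binary_dihedral :: "complex \<Rightarrow> (complex ^ 2 ^ 2) set" where
  "binary_dihedral \<zeta> = generate SU2
     {vector [vector [inverse \<zeta>, 0], vector [0, \<zeta>]],
      vector [vector [0, \<i>], vector [\<i>, 0]]}"

definition centralizer_algebra :: "complex \<Rightarrow> ('k::finite tensor \<Rightarrow> 'k tensor) set" where
  "centralizer_algebra \<zeta> =
     {f. Vector_Spaces.linear (*s) (*s) f \<and>
         (\<forall>x\<in>binary_dihedral \<zeta>. \<forall>w. f (tensor_power x w) = tensor_power x (f w))}"


text \<open>
  Modules over a complex algebra \<open>Z\<close> of linear endomorphisms of some \<open>complex ^ 'i\<close>. The module is a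
  subspace \<open>U\<close> of an arbitrary complex vector space (with scaling \<open>sc\<close>), and \<open>\<rho>\<close> is an arbitrary
  action of \<open>Z\<close> on it; the action need not come from evaluating elements of \<open>Z\<close>.
\<close>

definition algebra_module ::
  "(complex ^ 'i::finite \<Rightarrow> complex ^ 'i) set \<Rightarrow> (complex \<Rightarrow> 'm \<Rightarrow> 'm) \<Rightarrow> 'm::ab_group_add set \<Rightarrow>
   ((complex ^ 'i \<Rightarrow> complex ^ 'i) \<Rightarrow> 'm \<Rightarrow> 'm) \<Rightarrow> bool" where
  "algebra_module Z sc U \<rho> \<longleftrightarrow>
     vector_space sc \<and> module.subspace sc U \<and>
     (\<forall>x\<in>Z. \<forall>u\<in>U. \<rho> x u \<in> U) \<and>
     (\<forall>x\<in>Z. \<forall>u\<in>U. \<forall>v\<in>U. \<rho> x (u + v) = \<rho> x u + \<rho> x v) \<and>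
     (\<forall>x\<in>Z. \<forall>c. \<forall>u\<in>U. \<rho> x (sc c u) = sc c (\<rho> x u)) \<and>
     (\<forall>x\<in>Z. \<forall>y\<in>Z. \<forall>u\<in>U. \<rho> (\<lambda>w. x w + y w) u = \<rho> x u + \<rho> y u) \<and>
     (\<forall>x\<in>Z. \<forall>c. \<forall>u\<in>U. \<rho> (\<lambda>w. c *s x w) u = sc c (\<rho> x u)) \<and>
     (\<forall>x\<in>Z. \<forall>y\<in>Z. \<forall>u\<in>U. \<rho> (x \<circ> y) u = \<rho> x (\<rho> y u)) \<and>
     (\<forall>u\<in>U. \<rho> id u = u)"

definition irreducible_module ::
  "(complex ^ 'i::finite \<Rightarrow> complex ^ 'i) set \<Rightarrow> (complex \<Rightarrow> 'm \<Rightarrow> 'm) \<Rightarrow> 'm::ab_group_add set \<Rightarrow>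
   ((complex ^ 'i \<Rightarrow> complex ^ 'i) \<Rightarrow> 'm \<Rightarrow> 'm) \<Rightarrow> bool" where
  "irreducible_module Z sc U \<rho> \<longleftrightarrow>
     algebra_module Z sc U \<rho> \<and> U \<noteq> {0} \<and>
     (\<forall>W \<subseteq> U. module.subspace sc W \<and> (\<forall>x\<in>Z. \<forall>w\<in>W. \<rho> x w \<in> W) \<longrightarrow> W = {0} \<or> W = U)"

definition isomorphic_modules ::
  "(complex ^ 'i::finite \<Rightarrow> complex ^ 'i) set \<Rightarrow>
   (complex \<Rightarrow> 'm \<Rightarrow> 'm) \<Rightarrow> 'm::ab_group_add set \<Rightarrow>
   ((complex ^ 'i \<Rightarrow> complex ^ 'i) \<Rightarrow> 'm \<Rightarrow> 'm) \<Rightarrow>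
   (complex \<Rightarrow> 'p \<Rightarrow> 'p) \<Rightarrow> 'p::ab_group_add set \<Rightarrow>
   ((complex ^ 'i \<Rightarrow> complex ^ 'i) \<Rightarrow> 'p \<Rightarrow> 'p) \<Rightarrow> bool" where
  "isomorphic_modules Z sc U \<rho> sc' U' \<rho>' \<longleftrightarrow>
     (\<exists>\<phi>. bij_betw \<phi> U U' \<and>
          (\<forall>u\<in>U. \<forall>v\<in>U. \<phi> (u + v) = \<phi> u + \<phi> v) \<and>
          (\<forall>c. \<forall>u\<in>U. \<phi> (sc c u) = sc' c (\<phi> u)) \<and>
          (\<forall>x\<in>Z. \<forall>u\<in>U. \<phi> (\<rho> x u) = \<rho>' x (\<phi> u)))"

text \<open>The action of endomorphisms of \<open>complex ^ 'i\<close> on subspaces of \<open>complex ^ 'i\<close> by evaluation.\<close>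

definition eval_action :: "(complex ^ 'i \<Rightarrow> complex ^ 'i) \<Rightarrow> complex ^ 'i \<Rightarrow> complex ^ 'i" where
  "eval_action f w = f w"


definition signs :: "('k \<Rightarrow> int) set" where
  "signs = {r. \<forall>j. r j \<in> {-1, 1}}"

definition vbasis :: "int \<Rightarrow> complex ^ 2" where
  "vbasis s = (if s = -1 then vector [1, 0] else vector [0, 1])"

definition vtensor :: "('k::finite \<Rightarrow> int) \<Rightarrow> 'k tensor" where
  "vtensor r = pure_tensor (\<lambda>j. vbasis (r j))"

definition minus_count :: "('k::finite \<Rightarrow> int) \<Rightarrow> nat" where
  "minus_count r = card {j. r j = -1}"

definition sign_ge :: "('k::{finite,linorder} \<Rightarrow> int) \<Rightarrow> ('k \<Rightarrow> int) \<Rightarrow> bool" where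
  "sign_ge r s \<longleftrightarrow> minus_count r \<le> minus_count s \<and>
     (minus_count r = minus_count s \<longrightarrow> r = s \<or> less_fun s r)"

definition sign_gt :: "('k::{finite,linorder} \<Rightarrow> int) \<Rightarrow> ('k \<Rightarrow> int) \<Rightarrow> bool" where
  "sign_gt r s \<longleftrightarrow> sign_ge r s \<and> r \<noteq> s"

definition \<Lambda> :: "nat \<Rightarrow> nat \<Rightarrow> nat set" where
  "\<Lambda> n k = {l\<in>{0..n}. \<exists>a\<in>{0..k}. [int l = int k - 2 * int a] (mod 2 * int n)}"

definition a_min :: "nat \<Rightarrow> nat \<Rightarrow> nat \<Rightarrow> nat" where
  "a_min n k l = (LEAST a. a \<in> {0..k} \<and> [int l = int k - 2 * int a] (mod 2 * int n))"

text \<open>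
  The condition \<open>r \<succ> -r\<close> selects one element from each pair \<open>{r,
  -r}\<close>. The source writes it for every \<open>l\<close>; here, as a correction, it is imposed
  only for \<open>l \<in> {0, n}\<close>, where \<open>r\<close> and \<open>-r\<close> satisfy the
  same congruence. For \<open>0 < l < n\<close> they never do, and imposing it would discard
  sequences that the dimension formula counts: for \<open>n = 2\<close>, \<open>k = 3\<close>,
  \<open>l = 1\<close> the sequence \<open>r = (-1,-1,-1)\<close> satisfies the congruence but not
  \<open>r \<succ> -r\<close>, and the remaining three sequences span neither a submodule nor a
  space of the required dimension \<open>4\<close>.
\<close>

definition K :: "nat \<Rightarrow> nat \<Rightarrow> ('k::{finite,linorder} \<Rightarrow> int) set" where
  "K n l = {r \<in> signs. [int CARD('k) - 2 * int (minus_count r) = int l] (mod 2 * int n) \<and>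
                       (l \<in> {0, n} \<longrightarrow> sign_gt r (- r))}"

definition Zmod :: "nat \<Rightarrow> nat \<Rightarrow> 'k::{finite,linorder} tensor set" where
  "Zmod n l = vec.span {vtensor t | t. t \<in> K n l}"

text \<open>For \<open>l \<in> {0, n}\<close>: the modules with label \<open>l\<close> (plus sign) and \<open>l'\<close> (minus sign).\<close>

definition Zmod_plus :: "nat \<Rightarrow> nat \<Rightarrow> 'k::{finite,linorder} tensor set" where
  "Zmod_plus n l =
     vec.span {vtensor t + (\<i> powi (int l - int CARD('k))) *s vtensor (- t) | t. t \<in> K n l}"

definition Zmod_minus :: "nat \<Rightarrow> nat \<Rightarrow> 'k::{finite,linorder} tensor set" where
  "Zmod_minus n l =
     vec.span {vtensor t - (\<i> powi (int l - int CARD('k))) *s vtensor (- t) | t. t \<in> K n l}"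

text \<open>
  The coefficient of \<open>z ^ a\<close> (exponent read modulo \<open>n\<close>) in the image of \<open>p\<close> in \<open>\<complex>[z]/(z ^ n - 1)\<close>,
  with respect to the basis \<open>1, z, \<dots>, z ^ (n - 1)\<close>.
\<close>

definition cyclic_coeff :: "nat \<Rightarrow> complex poly \<Rightarrow> nat \<Rightarrow> complex" where
  "cyclic_coeff n p a = coeff (p mod (monom 1 n - 1)) (a mod n)"

end

theory Submission
  imports Defs
begin

text \<open>
  In the basis of tensors \<open>v\<^sub>r\<close> the rotation \<open>g\<close> is diagonal, with eigenvalue \<open>\<zeta>\<close> to the power
  \<open>k - 2 |r|\<close> (the weight of \<open>r\<close>), and \<open>h\<close> is a scalar multiple of the reflection \<open>v\<^sub>r \<mapsto> v\<^sub>-\<^sub>r\<close>. An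
  endomorphism therefore commutes with the group exactly if its matrix is block diagonal for the
  classes of weights modulo \<open>2 n\<close> and invariant under simultaneous negation of row and column index
  (\<open>centralizer_algebra_iff\<close>). Such matrices are spanned by the sums of the elementary matrices at
  \<open>(r, s)\<close> and \<open>(-r, -s)\<close>.

  Everything follows from how these sums act. If the class of \<open>l\<close> differs from that of \<open>-l\<close>, that is
  for \<open>0 < l < n\<close>, they are matrix units on the weight space of \<open>l\<close>, and the weight space of \<open>-l\<close>
  is a second copy of the same module. For \<open>l\<close> equal to \<open>0\<close> or \<open>n\<close> the weight space is stable under
  reflection and splits into the eigenspaces for \<open>1\<close> and \<open>-1\<close>, with bases \<open>v\<^sub>r + v\<^sub>-\<^sub>r\<close> and
  \<open>v\<^sub>r - v\<^sub>-\<^sub>r\<close>, on each of which the sums are again matrix units. A space on which an algebra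
  contains all matrix units is irreducible (\<open>irreducible_by_matrix_units\<close>), and its dimension is
  found by counting sign sequences.

  For completeness, the identity is a combination of idempotents \<open>e\<close> with \<open>e Z e = \<complex> e\<close>, each of
  which acts nontrivially on one of the listed modules. Some \<open>e\<close> acts nontrivially on a given
  irreducible module; and two irreducible modules on which the same such \<open>e\<close> is nonzero are isomorphic
  (\<open>isomorphic_by_minimal_idempotent\<close>), since a vector fixed by \<open>e\<close> has the same annihilator in both.
  This works for an arbitrary action on an arbitrary vector space and avoids the general theory
  of semisimple algebras.
\<close>

section \<open>Modules over algebras of endomorphisms\<close>

lemma linear_scaling_iff:
  fixes f :: "complex ^ 'i::finite \<Rightarrow> complex ^ 'j::finite"
  shows "Vector_Spaces.linear (*s) (*s) f \<longleftrightarrow>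
    (\<forall>x y. f (x + y) = f x + f y) \<and> (\<forall>c x. f (c *s x) = c *s f x)"
  by (simp add: Vector_Spaces.linear_iff vec.vector_space_axioms)

definition endomorphism_algebra :: "(complex ^ 'i::finite \<Rightarrow> complex ^ 'i) set \<Rightarrow> bool" where
  "endomorphism_algebra Z \<longleftrightarrow>
     (\<forall>x\<in>Z. Vector_Spaces.linear (*s) (*s) x) \<and> id \<in> Z \<and>
     (\<forall>x\<in>Z. \<forall>y\<in>Z. (\<lambda>w. x w + y w) \<in> Z \<and> x \<circ> y \<in> Z) \<and>
     (\<forall>x\<in>Z. \<forall>c. (\<lambda>w. c *s x w) \<in> Z)"

lemma endomorphism_algebraD:
  assumes "endomorphism_algebra Z"
  shows "id \<in> Z"
    and "x \<in> Z \<Longrightarrow> y \<in> Z \<Longrightarrow> (\<lambda>w. x w + y w) \<in> Z"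
    and "x \<in> Z \<Longrightarrow> y \<in> Z \<Longrightarrow> x \<circ> y \<in> Z"
    and "x \<in> Z \<Longrightarrow> (\<lambda>w. c *s x w) \<in> Z"
    and "x \<in> Z \<Longrightarrow> Vector_Spaces.linear (*s) (*s) x"
  using assms by (auto simp: endomorphism_algebra_def)

lemma endomorphism_algebra_zero: "endomorphism_algebra Z \<Longrightarrow> (\<lambda>w. 0) \<in> Z"
  using endomorphism_algebraD(4)[of Z id 0] endomorphism_algebraD(1)[of Z] by simp

lemma endomorphism_algebra_sum:
  assumes "endomorphism_algebra Z" "\<And>i. i \<in> I \<Longrightarrow> x i \<in> Z"
  shows "(\<lambda>w. \<Sum>i\<in>I. x i w) \<in> Z"
  using assms(2)
proof (induction I rule: infinite_finite_induct)
  case (insert i I)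
  then show ?case
    using endomorphism_algebraD(2)[OF assms(1), of "x i" "\<lambda>w. \<Sum>i\<in>I. x i w"] by simp
qed (simp_all add: endomorphism_algebra_zero[OF assms(1)])

lemma algebra_moduleD:
  assumes "algebra_module Z sc U \<rho>"
  shows "vector_space sc" "module.subspace sc U"
    and "x \<in> Z \<Longrightarrow> u \<in> U \<Longrightarrow> \<rho> x u \<in> U"
    and "x \<in> Z \<Longrightarrow> u \<in> U \<Longrightarrow> v \<in> U \<Longrightarrow> \<rho> x (u + v) = \<rho> x u + \<rho> x v"
    and "x \<in> Z \<Longrightarrow> u \<in> U \<Longrightarrow> \<rho> x (sc c u) = sc c (\<rho> x u)"
    and "x \<in> Z \<Longrightarrow> y \<in> Z \<Longrightarrow> u \<in> U \<Longrightarrow> \<rho> (\<lambda>w. x w + y w) u = \<rho> x u + \<rho> y u"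
    and "x \<in> Z \<Longrightarrow> u \<in> U \<Longrightarrow> \<rho> (\<lambda>w. c *s x w) u = sc c (\<rho> x u)"
    and "x \<in> Z \<Longrightarrow> y \<in> Z \<Longrightarrow> u \<in> U \<Longrightarrow> \<rho> (x \<circ> y) u = \<rho> x (\<rho> y u)"
    and "u \<in> U \<Longrightarrow> \<rho> id u = u"
  using assms unfolding algebra_module_def by blast+

lemma algebra_module_zero:
  assumes "endomorphism_algebra Z" "algebra_module Z sc U \<rho>" "u \<in> U"
  shows "\<rho> (\<lambda>w. 0) u = 0"
proof -
  interpret vector_space sc by (rule algebra_moduleD(1)[OF assms(2)])
  show ?thesis
    using algebra_moduleD(7)[OF assms(2) endomorphism_algebra_zero[OF assms(1)] assms(3), of 0] by simp
qed

lemma algebra_module_sum: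
  assumes "endomorphism_algebra Z" "algebra_module Z sc U \<rho>" "u \<in> U" "\<And>i. i \<in> I \<Longrightarrow> x i \<in> Z"
  shows "\<rho> (\<lambda>w. \<Sum>i\<in>I. x i w) u = (\<Sum>i\<in>I. \<rho> (x i) u)"
  using assms(4)
proof (induction I rule: infinite_finite_induct)
  case (insert i I)
  then show ?case
    using algebra_moduleD(6)[OF assms(2) _ endomorphism_algebra_sum[OF assms(1)] assms(3), of "x i" I x]
    by simp
qed (simp_all add: algebra_module_zero[OF assms(1-3)])

text \<open>The orbit of \<open>u\<close> is a submodule, and it contains \<open>u\<close> because the identity lies in \<open>Z\<close>.\<close>

lemma irreducible_module_cyclic:
  assumes Z: "endomorphism_algebra Z" and irr: "irreducible_module Z sc U \<rho>"
    and u: "u \<in> U" "u \<noteq> 0"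
  shows "(\<lambda>z. \<rho> z u) ` Z = U"
proof -
  let ?W = "(\<lambda>z. \<rho> z u) ` Z"
  from irr have M: "algebra_module Z sc U \<rho>"
    and min: "\<And>W. W \<subseteq> U \<Longrightarrow> module.subspace sc W \<Longrightarrow> \<forall>x\<in>Z. \<forall>w\<in>W. \<rho> x w \<in> W \<Longrightarrow> W = {0} \<or> W = U"
    unfolding irreducible_module_def by blast+
  note M = algebra_moduleD[OF M] algebra_module_zero[OF Z M]
  note Z = endomorphism_algebraD[OF Z] endomorphism_algebra_zero[OF Z]
  interpret vector_space sc by (rule M(1))
  have "?W \<subseteq> U" using M(3) u by auto
  moreover have "subspace ?W"
  proof (rule subspaceI)
    show "0 \<in> ?W" using M(10)[OF u(1)] Z(6) by (metis imageI)
  next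
    fix a b assume "a \<in> ?W" "b \<in> ?W"
    then obtain x y where "x \<in> Z" "y \<in> Z" "a = \<rho> x u" "b = \<rho> y u" by blast
    then show "a + b \<in> ?W"
      using M(6)[of x y u] u by (intro image_eqI[OF _ Z(2)[of x y]]) simp_all
  next
    fix c a assume "a \<in> ?W"
    then obtain x where "x \<in> Z" "a = \<rho> x u" by blast
    then show "sc c a \<in> ?W"
      using M(7)[of x u c] u by (intro image_eqI[OF _ Z(4)[of x c]]) simp_all
  qed
  moreover have "\<forall>x\<in>Z. \<forall>w\<in>?W. \<rho> x w \<in> ?W"
  proof (intro ballI)
    fix x w assume "x \<in> Z" "w \<in> ?W"
    then obtain y where "y \<in> Z" "w = \<rho> y u" by blast
    then show "\<rho> x w \<in> ?W"
      using M(8)[of x y u] u \<open>x \<in> Z\<close> by (intro image_eqI[OF _ Z(3)[of x y]]) simp_all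
  qed
  ultimately have "?W = {0} \<or> ?W = U" by (rule min)
  moreover have "u \<in> ?W" using M(9)[OF u(1)] Z(1) by (metis imageI)
  ultimately show ?thesis using u by blast
qed

text \<open>
  Let \<open>e\<close> be an idempotent with \<open>e Z e = \<complex> e\<close> and \<open>u\<close> a nonzero vector fixed by \<open>e\<close> in an irreducible
  module. If \<open>z u \<noteq> 0\<close>, some \<open>y\<close> returns \<open>z u\<close> to \<open>u\<close>, so \<open>e y z e\<close> is not \<open>0\<close>. Hence the annihilator of
  \<open>u\<close> is described by \<open>e\<close> alone.
\<close>

lemma annihilator_of_minimal_idempotent:
  assumes Z: "endomorphism_algebra Z" and irr: "irreducible_module Z sc U \<rho>"
    and e: "e \<in> Z" "e \<circ> e = e" "\<forall>z\<in>Z. \<exists>c. e \<circ> z \<circ> e = (\<lambda>w. c *s e w)"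
    and u: "u \<in> U" "u \<noteq> 0" "\<rho> e u = u" and z: "z \<in> Z"
  shows "\<rho> z u = 0 \<longleftrightarrow> (\<forall>y\<in>Z. e \<circ> y \<circ> z \<circ> e = (\<lambda>w. 0))"
proof -
  from irr have M: "algebra_module Z sc U \<rho>" unfolding irreducible_module_def by blast
  note M = algebra_moduleD[OF M] algebra_module_zero[OF Z M]
  note ZZ = endomorphism_algebraD[OF Z] endomorphism_algebra_zero[OF Z]
  interpret vector_space sc by (rule M(1))
  have comp: "\<rho> (e \<circ> y \<circ> z \<circ> e) u = \<rho> e (\<rho> y (\<rho> z u))" if "y \<in> Z" for y
    using that z e(1) u M(3,8) ZZ(3) by metis
  show ?thesis
  proof
    assume 0: "\<rho> z u = 0"
    show "\<forall>y\<in>Z. e \<circ> y \<circ> z \<circ> e = (\<lambda>w. 0)"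
    proof
      fix y assume y: "y \<in> Z"
      have kill: "\<rho> x 0 = 0" if "x \<in> Z" for x
        using M(5)[OF that u(1), of 0] by simp
      obtain c where c: "e \<circ> (y \<circ> z) \<circ> e = (\<lambda>w. c *s e w)"
        using e(3) ZZ(3)[OF y z] by blast
      have "0 = \<rho> (e \<circ> y \<circ> z \<circ> e) u" using comp[OF y] 0 kill y e(1) by simp
      also have "\<dots> = sc c u" using c M(7)[OF e(1) u(1), of c] u(3) by (simp add: comp_assoc)
      finally have "c = 0" using u(2) by simp
      then show "e \<circ> y \<circ> z \<circ> e = (\<lambda>w. 0)" using c by (simp add: comp_assoc)
    qed
  next
    assume R: "\<forall>y\<in>Z. e \<circ> y \<circ> z \<circ> e = (\<lambda>w. 0)"
    show "\<rho> z u = 0"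
    proof (rule ccontr)
      assume "\<rho> z u \<noteq> 0"
      then obtain y where y: "y \<in> Z" "\<rho> y (\<rho> z u) = u"
        using irreducible_module_cyclic[OF Z irr, of "\<rho> z u"] M(3)[OF z u(1)] u(1)
        by (metis (no_types, lifting) imageE)
      then have "u = \<rho> (e \<circ> y \<circ> z \<circ> e) u" using comp u(3) by simp
      also have "\<dots> = 0" using R y M(10)[OF u(1)] by simp
      finally show False using u(2) by simp
    qed
  qed
qed

text \<open>
  Both modules are quotients of \<open>Z\<close> by the annihilator of a vector fixed by \<open>e\<close>, and the two
  annihilators agree.
\<close>

lemma isomorphic_by_minimal_idempotent:
  assumes Z: "endomorphism_algebra Z"
    and irr: "irreducible_module Z sc U \<rho>" and irr': "irreducible_module Z sc' U' \<rho>'"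
    and e: "e \<in> Z" "e \<circ> e = e" "\<forall>z\<in>Z. \<exists>c. e \<circ> z \<circ> e = (\<lambda>w. c *s e w)"
    and u0: "u0 \<in> U" "\<rho> e u0 \<noteq> 0" and u0': "u0' \<in> U'" "\<rho>' e u0' \<noteq> 0"
  shows "isomorphic_modules Z sc U \<rho> sc' U' \<rho>'"
proof -
  from irr have M: "algebra_module Z sc U \<rho>" unfolding irreducible_module_def by blast
  from irr' have M': "algebra_module Z sc' U' \<rho>'" unfolding irreducible_module_def by blast
  note M = algebra_moduleD[OF M] algebra_module_zero[OF Z M]
  note M' = algebra_moduleD[OF M'] algebra_module_zero[OF Z M']
  note ZZ = endomorphism_algebraD[OF Z] endomorphism_algebra_zero[OF Z]
  interpret vector_space sc by (rule M(1))
  interpret v': vector_space sc' by (rule M'(1))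
  define u where "u = \<rho> e u0"
  define u' where "u' = \<rho>' e u0'"
  have u: "u \<in> U" "u \<noteq> 0" "\<rho> e u = u"
    using M(3)[OF e(1) u0(1)] u0(2) M(8)[OF e(1) e(1) u0(1)] e(2) by (simp_all add: u_def)
  have u': "u' \<in> U'" "u' \<noteq> 0" "\<rho>' e u' = u'"
    using M'(3)[OF e(1) u0'(1)] u0'(2) M'(8)[OF e(1) e(1) u0'(1)] e(2) by (simp_all add: u'_def)
  have ann: "\<rho> z u = 0 \<longleftrightarrow> \<rho>' z u' = 0" if "z \<in> Z" for z
    using annihilator_of_minimal_idempotent[OF Z irr e u that]
      annihilator_of_minimal_idempotent[OF Z irr' e u' that] by simp
  have same: "\<rho> y u = \<rho> z u \<longleftrightarrow> \<rho>' y u' = \<rho>' z u'" if "y \<in> Z" "z \<in> Z" for y z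
  proof -
    let ?d = "\<lambda>w. y w + (-1) *s z w"
    have m: "(\<lambda>w. (-1) *s z w) \<in> Z" using ZZ(4) that by blast
    have "\<rho> ?d u = \<rho> y u - \<rho> z u"
      using M(6)[OF that(1) m u(1)] M(7)[OF that(2) u(1), of "-1"] by simp
    moreover have "\<rho>' ?d u' = \<rho>' y u' - \<rho>' z u'"
      using M'(6)[OF that(1) m u'(1)] M'(7)[OF that(2) u'(1), of "-1"] by simp
    moreover have "?d \<in> Z" using ZZ(2)[OF that(1) m] .
    ultimately show ?thesis using ann[of ?d] by simp
  qed
  have U: "(\<lambda>z. \<rho> z u) ` Z = U" using irreducible_module_cyclic[OF Z irr u(1,2)] .
  have U': "(\<lambda>z. \<rho>' z u') ` Z = U'" using irreducible_module_cyclic[OF Z irr' u'(1,2)] .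
  \<comment> \<open>The map \<open>z u \<mapsto> z u'\<close>, computed from a chosen representative \<open>z\<close>.\<close>
  define rep where "rep x = (SOME z. z \<in> Z \<and> \<rho> z u = x)" for x
  define \<phi> where "\<phi> x = \<rho>' (rep x) u'" for x
  have \<phi>: "\<phi> (\<rho> z u) = \<rho>' z u'" if "z \<in> Z" for z
  proof -
    have "rep (\<rho> z u) \<in> Z \<and> \<rho> (rep (\<rho> z u)) u = \<rho> z u"
      unfolding rep_def by (rule someI[of _ z]) (simp add: that)
    then show ?thesis using same[of "rep (\<rho> z u)" z] that by (simp add: \<phi>_def)
  qed
  have ex: "\<exists>z\<in>Z. x = \<rho> z u" if "x \<in> U" for x using U that by blast
  have "\<phi> ` U = U'"
    unfolding U[symmetric] U'[symmetric] image_image using \<phi> by simp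
  moreover have "inj_on \<phi> U"
    by (rule inj_onI) (metis ex \<phi> same)
  moreover have "\<phi> (a + b) = \<phi> a + \<phi> b" if "a \<in> U" "b \<in> U" for a b
  proof -
    obtain x y where "x \<in> Z" "a = \<rho> x u" "y \<in> Z" "b = \<rho> y u" using ex \<open>a \<in> U\<close> \<open>b \<in> U\<close> by metis
    then show ?thesis
      using M(6)[of x y u, symmetric] M'(6)[of x y u'] u(1) u'(1) \<phi> ZZ(2)[of x y] by simp
  qed
  moreover have "\<phi> (sc c a) = sc' c (\<phi> a)" if "a \<in> U" for a c
  proof -
    obtain x where "x \<in> Z" "a = \<rho> x u" using ex \<open>a \<in> U\<close> by metis
    then show ?thesis
      using M(7)[of x u c, symmetric] M'(7)[of x u' c] u(1) u'(1) \<phi> ZZ(4)[of x c] by simp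
  qed
  moreover have "\<phi> (\<rho> x a) = \<rho>' x (\<phi> a)" if "x \<in> Z" "a \<in> U" for x a
  proof -
    obtain y where "y \<in> Z" "a = \<rho> y u" using ex \<open>a \<in> U\<close> by metis
    then show ?thesis
      using M(8)[of x y u, symmetric] M'(8)[of x y u'] u(1) u'(1) \<phi> ZZ(3)[of x y] \<open>x \<in> Z\<close> by simp
  qed
  ultimately show ?thesis
    unfolding isomorphic_modules_def bij_betw_def by blast
qed

lemma span_image_expansion:
  fixes b :: "'a \<Rightarrow> complex ^ 'i::finite"
  assumes "finite J" "w \<in> vec.span (b ` J)"
  obtains c where "w = (\<Sum>q\<in>J. c q *s b q)"
proof -
  have "\<exists>c. w = (\<Sum>q\<in>J. c q *s b q)"
    using assms(2)
  proof (induction rule: vec.span_induct_alt)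
    case base
    show ?case by (rule exI[of _ "\<lambda>_. 0"]) simp
  next
    case (step d x y)
    then obtain q c where q: "q \<in> J" "x = b q" and y: "y = (\<Sum>q\<in>J. c q *s b q)" by blast
    have "d *s x + y = (\<Sum>p\<in>J. (c p + (if p = q then d else 0)) *s b p)"
      using q assms(1) by (simp add: y vec.scale_left_distrib sum.distrib if_distrib[of "\<lambda>a. a *s _"] cong: if_cong)
    then show ?case by (intro exI) 
  qed
  then show ?thesis using that by blast
qed

text \<open>
  The operators in the last assumption act on the span of the \<open>b q\<close> as matrix units, so they carry
  any nonzero vector to a nonzero multiple of each \<open>b s\<close>; they also separate the \<open>b q\<close>, which are
  therefore a basis.
\<close>

lemma irreducible_by_matrix_units:
  fixes b :: "'a \<Rightarrow> complex ^ 'i::finite"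
  assumes Z: "endomorphism_algebra Z" and J: "finite J" "J \<noteq> {}"
    and nz: "\<And>t. t \<in> J \<Longrightarrow> b t \<noteq> 0"
    and stable: "\<And>z t. z \<in> Z \<Longrightarrow> t \<in> J \<Longrightarrow> z (b t) \<in> vec.span (b ` J)"
    and units: "\<And>s t. s \<in> J \<Longrightarrow> t \<in> J \<Longrightarrow> \<exists>z\<in>Z. \<forall>q\<in>J. z (b q) = (if q = t then b s else 0)"
  shows "irreducible_module Z (*s) (vec.span (b ` J)) eval_action"
    and "vec.dim (vec.span (b ` J)) = card J"
proof -
  let ?V = "vec.span (b ` J)"
  note ZZ = endomorphism_algebraD[OF Z]
  have lin: "z (x + y) = z x + z y" "z (c *s x) = c *s z x" if "z \<in> Z" for z x y c
    using ZZ(5)[OF that] by (simp_all add: linear_scaling_iff)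
  have zero: "z 0 = 0" if "z \<in> Z" for z using lin(2)[OF that, of 0 0] by simp
  have lsum: "z (\<Sum>q\<in>J. c q *s b q) = (\<Sum>q\<in>J. c q *s z (b q))" if "z \<in> Z" for z c
    using J(1)
  proof (induction J)
    case (insert x F) then show ?case by (simp add: lin[OF that])
  qed (simp add: zero that)
  have pick: "\<exists>z\<in>Z. z (\<Sum>q\<in>J. c q *s b q) = c t *s b s" if "s \<in> J" "t \<in> J" for c s t
  proof -
    obtain z where z: "z \<in> Z" "\<forall>q\<in>J. z (b q) = (if q = t then b s else 0)"
      using units[OF \<open>s \<in> J\<close> \<open>t \<in> J\<close>] by blast
    have "z (\<Sum>q\<in>J. c q *s b q) = (\<Sum>q\<in>J. c q *s (if q = t then b s else 0))"
      unfolding lsum[OF z(1)] using z(2) by (intro sum.cong) simp_all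
    also have "\<dots> = c t *s b s"
      using that J(1) by (simp add: if_distrib[of "\<lambda>x. _ *s x"] cong: if_cong)
    finally show ?thesis using z(1) by blast
  qed
  have stab: "z w \<in> ?V" if "z \<in> Z" "w \<in> ?V" for z w
  proof -
    obtain c where "w = (\<Sum>q\<in>J. c q *s b q)" using span_image_expansion[OF J(1) \<open>w \<in> ?V\<close>] .
    then show ?thesis
      by (simp add: lsum[OF that(1)] vec.span_sum vec.span_scale stable[OF that(1)])
  qed
  have "algebra_module Z (*s) ?V eval_action"
    unfolding algebra_module_def eval_action_def
    using vec.vector_space_axioms vec.subspace_span stab lin by auto
  moreover have "?V \<noteq> {0}"
    using J(2) nz vec.span_base[of _ "b ` J"] by blast
  moreover have "W = {0} \<or> W = ?V"
    if W: "W \<subseteq> ?V" "vec.subspace W" and inv: "\<forall>x\<in>Z. \<forall>w\<in>W. eval_action x w \<in> W" for W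
  proof (cases "W = {0}")
    case False
    then obtain w where w: "w \<in> W" "w \<noteq> 0" using vec.subspace_0[OF W(2)] by blast
    obtain c where c: "w = (\<Sum>q\<in>J. c q *s b q)" using span_image_expansion[OF J(1)] w W(1) by blast
    obtain t where t: "t \<in> J" "c t \<noteq> 0"
      using w(2) c by (metis (no_types, lifting) sum.neutral vector_smult_lzero)
    have "b s \<in> W" if "s \<in> J" for s
    proof -
      obtain z where "z \<in> Z" "z w = c t *s b s" using pick[OF \<open>s \<in> J\<close> t(1), of c] c by blast
      then have "c t *s b s \<in> W" using inv w(1) by (metis eval_action_def)
      then have "inverse (c t) *s (c t *s b s) \<in> W" using vec.subspace_scale[OF W(2)] by blast
      then show ?thesis using t(2) by (simp add: vector_smult_assoc)
    qed
    then have "?V \<subseteq> W" using vec.span_minimal[OF _ W(2), of "b ` J"] by blast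
    then show ?thesis using W(1) by blast
  qed simp
  ultimately show "irreducible_module Z (*s) ?V eval_action"
    unfolding irreducible_module_def by blast
  have inj: "inj_on b J"
  proof (rule inj_onI, rule ccontr)
    fix s t assume st: "s \<in> J" "t \<in> J" "b s = b t" "s \<noteq> t"
    obtain z where "z \<in> Z" "\<forall>q\<in>J. z (b q) = (if q = t then b t else 0)"
      using units[of t t] st by blast
    then show False using st nz by metis
  qed
  have "vec.independent (b ` J)"
  proof (rule vec.independent_if_scalars_zero)
    show "finite (b ` J)" using J(1) by simp
  next
    fix f x assume s: "(\<Sum>x\<in>b ` J. f x *s x) = 0" and "x \<in> b ` J"
    then obtain t where t: "t \<in> J" "x = b t" by blast
    have "(\<Sum>q\<in>J. f (b q) *s b q) = 0" using s by (simp add: sum.reindex[OF inj] o_def)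
    then obtain z where "z \<in> Z" "z 0 = f (b t) *s b t"
      using pick[OF t(1) t(1), of "\<lambda>q. f (b q)"] by metis
    then have "f (b t) *s b t = 0" using zero by metis
    then show "f x = 0" using nz[OF t(1)] t(2) vec.scale_eq_0_iff by blast
  qed
  then show "vec.dim ?V = card J"
    using card_image[OF inj] by (simp add: vec.dim_span vec.dim_eq_card_independent)
qed

section \<open>The tensor action of the generators\<close>

text \<open>
  A sign sequence is encoded by \<open>\<iota> :: 'k \<Rightarrow> 2\<close>, the value \<open>1\<close> standing for the sign \<open>-1\<close> and the
  value \<open>2\<close> for the sign \<open>1\<close>, because \<open>v\<^sub>-\<^sub>1\<close> and \<open>v\<^sub>1\<close> are the first and the second unit vector.
\<close>

abbreviation unit_tensor :: "('k::finite \<Rightarrow> 2) \<Rightarrow> 'k tensor" where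
  "unit_tensor \<iota> \<equiv> axis \<iota> 1"

definition flip :: "('k \<Rightarrow> 2) \<Rightarrow> 'k \<Rightarrow> 2" where
  "flip \<iota> = (\<lambda>j. if \<iota> j = 1 then 2 else 1)"

definition weight :: "('k::finite \<Rightarrow> 2) \<Rightarrow> int" where
  "weight \<iota> = int CARD('k) - 2 * int (card {j. \<iota> j = 1})"

definition reflect :: "'k::finite tensor \<Rightarrow> 'k tensor" where
  "reflect w = (\<chi> \<iota>. w $ flip \<iota>)"

lemma flip_flip [simp]: "flip (flip \<iota>) = \<iota>"
  using exhaust_2 by (fastforce simp: flip_def fun_eq_iff)

lemma flip_eq_iff: "flip \<iota> = \<kappa> \<longleftrightarrow> \<iota> = flip \<kappa>"
  by (metis flip_flip)

lemma flip_neq [simp]: "flip \<iota> \<noteq> \<iota>" "\<iota> \<noteq> flip \<iota>"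
proof -
  have "flip \<iota> j \<noteq> \<iota> j" for j
    using exhaust_2[of "\<iota> j"] by (auto simp: flip_def)
  then show "flip \<iota> \<noteq> \<iota>" "\<iota> \<noteq> flip \<iota>" by metis+
qed

lemma bij_flip: "bij flip"
  by (rule o_bij[of flip]) (simp_all add: fun_eq_iff)

lemma weight_flip [simp]: "weight (flip \<iota>) = - weight (\<iota> :: 'k::finite \<Rightarrow> 2)"
proof -
  have "{j. flip \<iota> j = 1} = - {j. \<iota> j = 1}"
    by (auto simp: flip_def)
  then have "card {j. flip \<iota> j = 1} = CARD('k) - card {j. \<iota> j = 1}"
    by (simp add: Compl_eq_Diff_UNIV card_Diff_subset)
  moreover have "card {j. \<iota> j = 1} \<le> CARD('k)" by (rule card_mono) simp_all
  ultimately show ?thesis by (simp add: weight_def of_nat_diff)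
qed

lemma reflect_unit_tensor [simp]: "reflect (unit_tensor \<iota>) = unit_tensor (flip \<iota>)"
  by (auto simp: reflect_def vec_eq_iff axis_def flip_eq_iff)

lemma reflect_add_scale [simp]:
  "reflect (x + y) = reflect x + reflect y" "reflect (c *s x) = c *s reflect x"
  by (simp_all add: reflect_def vec_eq_iff)

lemma linear_coordinates:
  fixes f :: "complex ^ 'i::finite \<Rightarrow> complex ^ 'j::finite"
  assumes "Vector_Spaces.linear (*s) (*s) f"
  shows "f w = (\<Sum>\<kappa>\<in>UNIV. w $ \<kappa> *s f (axis \<kappa> 1))"
  using matrix_works[OF assms, of w]
  by (simp add: vec_eq_iff matrix_def matrix_vector_mult_def mult.commute)

lemma linear_eq_on_axes:
  fixes f g :: "complex ^ 'i::finite \<Rightarrow> complex ^ 'j::finite"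
  assumes "Vector_Spaces.linear (*s) (*s) f" "Vector_Spaces.linear (*s) (*s) g"
    and "\<And>\<kappa>. f (axis \<kappa> 1) = g (axis \<kappa> 1)"
  shows "f = g"
proof
  fix w
  show "f w = g w"
    unfolding linear_coordinates[OF assms(1), of w] linear_coordinates[OF assms(2), of w] assms(3) ..
qed

definition dihedral_rotation :: "complex \<Rightarrow> complex ^ 2 ^ 2" where
  "dihedral_rotation \<zeta> = vector [vector [inverse \<zeta>, 0], vector [0, \<zeta>]]"

definition dihedral_flip :: "complex ^ 2 ^ 2" where
  "dihedral_flip = vector [vector [0, \<i>], vector [\<i>, 0]]"

lemma generator_entries:
  "dihedral_rotation \<zeta> $ a $ b = (if a = b then if a = 1 then inverse \<zeta> else \<zeta> else 0)"
  "dihedral_flip $ a $ b = (if a = b then 0 else \<i>)"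
  using exhaust_2[of a] exhaust_2[of b]
  by (auto simp: dihedral_rotation_def dihedral_flip_def vector_def)

lemma tensor_power_rotation:
  fixes w :: "'k::finite tensor"
  assumes "\<zeta> \<noteq> 0"
  shows "tensor_power (dihedral_rotation \<zeta>) w = (\<chi> \<iota>. \<zeta> powi weight \<iota> * w $ \<iota>)"
proof -
  have entry: "(\<Prod>j\<in>UNIV. dihedral_rotation \<zeta> $ \<iota> j $ \<kappa> j) = (if \<iota> = \<kappa> then \<zeta> powi weight \<iota> else 0)"
    for \<iota> \<kappa> :: "'k \<Rightarrow> 2"
  proof (cases "\<iota> = \<kappa>")
    case True
    define a where "a = card {j. \<iota> j = 1}"
    have a: "a \<le> CARD('k)" unfolding a_def by (rule card_mono) simp_all
    have "(\<Prod>j\<in>UNIV. dihedral_rotation \<zeta> $ \<iota> j $ \<kappa> j) = (\<Prod>j\<in>UNIV. if \<iota> j = 1 then inverse \<zeta> else \<zeta>)"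
      using True by (simp add: generator_entries)
    also have "\<dots> = inverse \<zeta> ^ a * \<zeta> ^ (CARD('k) - a)"
      by (simp add: prod.If_cases a_def Compl_eq[symmetric] Compl_eq_Diff_UNIV card_Diff_subset)
    also have "\<dots> = \<zeta> powi (- int a) * \<zeta> powi (int CARD('k) - int a)"
      using a by (simp add: power_int_minus power_inverse of_nat_diff[symmetric] del: of_nat_diff)
    also have "\<dots> = \<zeta> powi weight \<iota>"
      using assms by (simp add: power_int_add[symmetric] weight_def a_def)
    finally show ?thesis using True by simp
  next
    case False
    then obtain j where "\<iota> j \<noteq> \<kappa> j" by blast
    then have "\<exists>j\<in>UNIV. dihedral_rotation \<zeta> $ \<iota> j $ \<kappa> j = 0"
      by (intro bexI[of _ j]) (simp_all add: generator_entries)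
    then show ?thesis using False by (simp add: prod_zero_iff)
  qed
  show ?thesis
    by (simp add: tensor_power_def vec_eq_iff matrix_vector_mult_def entry if_distrib[of "\<lambda>x. x * _"] cong: if_cong)
qed

text \<open>
  A product over the positions vanishes as soon as one position contributes a diagonal entry, so the
  tensor power is a monomial matrix.
\<close>

lemma tensor_power_dihedral_flip:
  fixes w :: "'k::finite tensor"
  shows "tensor_power dihedral_flip w = \<i> ^ CARD('k) *s reflect w"
proof -
  have entry: "(\<Prod>j\<in>UNIV. dihedral_flip $ \<iota> j $ \<kappa> j) = (if \<kappa> = flip \<iota> then \<i> ^ CARD('k) else 0)"
    for \<iota> \<kappa> :: "'k \<Rightarrow> 2"
  proof (cases "\<kappa> = flip \<iota>")
    case True
    have "dihedral_flip $ \<iota> j $ \<kappa> j = \<i>" for j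
      using True exhaust_2[of "\<iota> j"] by (auto simp: flip_def generator_entries)
    then show ?thesis using True by simp
  next
    case False
    then obtain j where "\<kappa> j \<noteq> flip \<iota> j" by blast
    then have "\<kappa> j = \<iota> j"
      using exhaust_2[of "\<iota> j"] exhaust_2[of "\<kappa> j"] by (auto simp: flip_def)
    then have "\<exists>j\<in>UNIV. dihedral_flip $ \<iota> j $ \<kappa> j = 0"
      by (intro bexI[of _ j]) (simp_all add: generator_entries)
    then show ?thesis using False by (simp add: prod_zero_iff)
  qed
  show ?thesis
    by (simp add: tensor_power_def vec_eq_iff matrix_vector_mult_def entry reflect_def
        if_distrib[of "\<lambda>x. x * _"] cong: if_cong)
qed

lemma tensor_power_mult:
  fixes w :: "'k::finite tensor"
  shows "tensor_power (A ** B) w = tensor_power A (tensor_power B w)"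
proof -
  have "(\<Prod>j\<in>UNIV. \<Sum>m\<in>UNIV. A $ \<iota> j $ m * B $ m $ \<kappa> j) =
      (\<Sum>\<mu>\<in>UNIV. (\<Prod>j\<in>UNIV. A $ \<iota> j $ \<mu> j) * (\<Prod>j\<in>UNIV. B $ \<mu> j $ \<kappa> j))"
    for \<iota> \<kappa> :: "'k \<Rightarrow> 2"
    by (subst prod_sum_PiE) (simp_all add: prod.distrib PiE_UNIV_domain)
  then show ?thesis
    by (simp add: tensor_power_def matrix_vector_mul_assoc matrix_matrix_mult_def)
qed

lemma tensor_power_one: "tensor_power (mat 1) w = (w :: 'k::finite tensor)"
proof -
  have "(\<Prod>j\<in>UNIV. (mat 1 :: complex ^ 2 ^ 2) $ \<iota> j $ \<kappa> j) = (if \<iota> = \<kappa> then 1 else 0)"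
    for \<iota> \<kappa> :: "'k \<Rightarrow> 2"
  proof (cases "\<iota> = \<kappa>")
    case False
    then obtain j where "\<iota> j \<noteq> \<kappa> j" by blast
    then have "\<exists>j\<in>UNIV. (mat 1 :: complex ^ 2 ^ 2) $ \<iota> j $ \<kappa> j = 0"
      by (intro bexI[of _ j]) (simp_all add: mat_def)
    then show ?thesis using False by (simp add: prod_zero_iff)
  qed (simp add: mat_def)
  then have "(\<chi> \<iota> \<kappa>. \<Prod>j\<in>UNIV. (mat 1 :: complex ^ 2 ^ 2) $ \<iota> j $ \<kappa> j) = (mat 1 :: complex ^ ('k \<Rightarrow> 2) ^ ('k \<Rightarrow> 2))"
    by (simp add: vec_eq_iff mat_def)
  then show ?thesis by (simp add: tensor_power_def)
qed

text \<open>
  The conjugate transpose of \<open>A\<close> lies in the group again and is a two-sided inverse, and associativity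
  leaves no room for a second one.
\<close>

lemma SU2_inverse:
  assumes "A \<in> carrier SU2"
  shows "A ** inv\<^bsub>SU2\<^esub> A = mat 1" "inv\<^bsub>SU2\<^esub> A ** A = mat 1"
proof -
  define B where "B = (\<chi> i j. cnj (A $ j $ i))"
  have A: "A ** B = mat 1" "det A = 1" using assms by (simp_all add: SU2_def B_def)
  then have BA: "B ** A = mat 1" using matrix_left_right_inverse by blast
  have "det B = 1" using det_mul[of A B] A by simp
  moreover have "(\<chi> i j. cnj (B $ j $ i)) = A" by (simp add: B_def vec_eq_iff)
  ultimately have B: "B \<in> carrier SU2" using BA by (simp add: SU2_def)
  have "inv\<^bsub>SU2\<^esub> A = B"
    unfolding m_inv_def
  proof (rule the_equality)
    show "B \<in> carrier SU2 \<and> A \<otimes>\<^bsub>SU2\<^esub> B = \<one>\<^bsub>SU2\<^esub> \<and> B \<otimes>\<^bsub>SU2\<^esub> A = \<one>\<^bsub>SU2\<^esub>"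
      using B A BA by (simp add: SU2_def)
  next
    fix C assume "C \<in> carrier SU2 \<and> A \<otimes>\<^bsub>SU2\<^esub> C = \<one>\<^bsub>SU2\<^esub> \<and> C \<otimes>\<^bsub>SU2\<^esub> A = \<one>\<^bsub>SU2\<^esub>"
    then have "C ** A = mat 1" by (simp add: SU2_def)
    then show "C = B" using A(1) by (metis matrix_mul_assoc matrix_mul_lid matrix_mul_rid)
  qed
  then show "A ** inv\<^bsub>SU2\<^esub> A = mat 1" "inv\<^bsub>SU2\<^esub> A ** A = mat 1" using A BA by simp_all
qed

lemma generators_in_SU2:
  assumes "norm \<zeta> = 1"
  shows "dihedral_rotation \<zeta> \<in> carrier SU2" "dihedral_flip \<in> carrier SU2"
proof -
  have z: "\<zeta> \<noteq> 0" "\<zeta> * cnj \<zeta> = 1"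
    using assms complex_norm_square[of \<zeta>] by auto
  have zi: "inverse \<zeta> * cnj (inverse \<zeta>) = 1"
    using z by (metis complex_cnj_inverse inverse_1 inverse_mult_distrib)
  show "dihedral_rotation \<zeta> \<in> carrier SU2"
    using z zi
    by (simp add: SU2_def det_2 generator_entries vec_eq_iff forall_2 matrix_matrix_mult_def sum_2 mat_def)
  show "dihedral_flip \<in> carrier SU2"
    by (simp add: SU2_def det_2 generator_entries vec_eq_iff forall_2 matrix_matrix_mult_def sum_2 mat_def)
qed

text \<open>
  The matrices whose action commutes with \<open>f\<close> are closed under products, and under inverses because
  \<open>f\<close> can be moved past \<open>h\<close> in \<open>h\<inverse> h f h\<inverse>\<close>.
\<close>

lemma commutes_with_binary_dihedral_iff:
  fixes f :: "'k::finite tensor \<Rightarrow> 'k tensor"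
  assumes "norm \<zeta> = 1"
  shows "(\<forall>x\<in>binary_dihedral \<zeta>. \<forall>w. f (tensor_power x w) = tensor_power x (f w)) \<longleftrightarrow>
    (\<forall>w. f (tensor_power (dihedral_rotation \<zeta>) w) = tensor_power (dihedral_rotation \<zeta>) (f w)) \<and>
    (\<forall>w. f (tensor_power dihedral_flip w) = tensor_power dihedral_flip (f w))"
    (is "?L \<longleftrightarrow> ?R")
proof
  have D: "binary_dihedral \<zeta> = generate SU2 {dihedral_rotation \<zeta>, dihedral_flip}"
    by (simp add: binary_dihedral_def dihedral_rotation_def dihedral_flip_def)
  show ?R if ?L
    using that unfolding D by (auto intro: generate.incl)
  show ?L if R: ?R
  proof
    fix x assume "x \<in> binary_dihedral \<zeta>"
    then show "\<forall>w. f (tensor_power x w) = tensor_power x (f w)"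
      unfolding D
    proof (induction rule: generate.induct)
      case one
      then show ?case by (simp add: SU2_def tensor_power_one)
    next
      case (incl h)
      then show ?case using R by blast
    next
      case (inv h)
      then have h: "h \<in> carrier SU2" and comm: "\<forall>w. f (tensor_power h w) = tensor_power h (f w)"
        using R generators_in_SU2[OF assms] by auto
      let ?h' = "inv\<^bsub>SU2\<^esub> h"
      show ?case
      proof
        fix w :: "'k tensor"
        have "f (tensor_power ?h' w) = tensor_power ?h' (tensor_power h (f (tensor_power ?h' w)))"
          by (simp add: tensor_power_mult[symmetric] SU2_inverse[OF h] tensor_power_one)
        also have "\<dots> = tensor_power ?h' (f (tensor_power h (tensor_power ?h' w)))"
          using comm by simp
        also have "\<dots> = tensor_power ?h' (f w)"
          by (simp add: tensor_power_mult[symmetric] SU2_inverse[OF h] tensor_power_one)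
        finally show "f (tensor_power ?h' w) = tensor_power ?h' (f w)" .
      qed
    next
      case (eng h1 h2)
      then show ?case by (simp add: SU2_def tensor_power_mult)
    qed
  qed
qed

section \<open>The centralizer algebra\<close>

lemma primitive_root_nonzero:
  assumes "primitive_root_of_unity m \<zeta>" "m > 0"
  shows "norm \<zeta> = 1" "\<zeta> \<noteq> 0"
proof -
  have "\<zeta> ^ m = 1" using assms by (simp add: primitive_root_of_unity_def)
  then show "norm \<zeta> = 1" using power_eq_1_iff[of \<zeta> m] assms(2) by auto
  then show "\<zeta> \<noteq> 0" by auto
qed

text \<open>
  Reduces an exponent to its residue in \<open>{0..<m}\<close>, where primitivity applies.
\<close>

lemma primitive_root_powi_eq_iff:
  assumes "primitive_root_of_unity m \<zeta>" "m > 0"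
  shows "\<zeta> powi a = \<zeta> powi b \<longleftrightarrow> [a = b] (mod int m)"
proof -
  note z = primitive_root_nonzero[OF assms]
  have one: "\<zeta> ^ m = 1" and prim: "\<And>j. 0 < j \<Longrightarrow> j < m \<Longrightarrow> \<zeta> ^ j \<noteq> 1"
    using assms by (auto simp: primitive_root_of_unity_def)
  define d where "d = a - b"
  define r where "r = nat (d mod int m)"
  have r: "int r = d mod int m" "r < m" using assms(2) by (simp_all add: r_def nat_less_iff)
  have "\<zeta> powi d = \<zeta> powi (int m * (d div int m) + int r)" by (simp add: r)
  also have "\<dots> = (\<zeta> ^ m) powi (d div int m) * \<zeta> ^ r"
    using z by (simp add: power_int_add power_int_mult)
  also have "\<dots> = \<zeta> ^ r" by (simp add: one)
  finally have "\<zeta> powi d = \<zeta> ^ r" .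
  then have "\<zeta> powi d = 1 \<longleftrightarrow> r = 0" using prim r(2) by (metis neq0_conv power_0)
  also have "\<dots> \<longleftrightarrow> [a = b] (mod int m)"
    using r(1) by (simp add: d_def cong_iff_dvd_diff dvd_eq_mod_eq_0 flip: of_nat_eq_0_iff[where 'a = int])
  finally show ?thesis
    using z by (simp add: d_def power_int_diff)
qed

text \<open>
  Commuting with the rotation \<open>g\<close> forces the matrix of \<open>f\<close> to be block diagonal for the classes of
  weights modulo \<open>2 n\<close>, since \<open>g\<close> multiplies \<open>unit_tensor \<iota>\<close> by \<open>\<zeta>\<close> to the power \<open>weight \<iota>\<close>;
  and \<open>h\<close> acts as a scalar multiple of \<open>reflect\<close>.
\<close>

lemma centralizer_algebra_iff:
  fixes f :: "'k::finite tensor \<Rightarrow> 'k tensor"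
  assumes \<zeta>: "primitive_root_of_unity (2 * n) \<zeta>" and n: "n > 0"
  shows "f \<in> centralizer_algebra \<zeta> \<longleftrightarrow> Vector_Spaces.linear (*s) (*s) f \<and>
    (\<forall>w. f (reflect w) = reflect (f w)) \<and>
    (\<forall>\<iota> \<kappa>. f (unit_tensor \<kappa>) $ \<iota> \<noteq> 0 \<longrightarrow> [weight \<iota> = weight \<kappa>] (mod 2 * int n))"
proof (cases "Vector_Spaces.linear (*s) (*s) f")
  case lin: True
  have z: "norm \<zeta> = 1" "\<zeta> \<noteq> 0" using primitive_root_nonzero[OF \<zeta>] n by simp_all
  have scale: "f (c *s x) = c *s f x" for x c
    using lin by (simp_all add: linear_scaling_iff)
  let ?G = "\<lambda>w :: 'k tensor. \<chi> \<iota>. \<zeta> powi weight \<iota> * w $ \<iota>"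
  have G1: "?G (unit_tensor \<kappa>) = \<zeta> powi weight \<kappa> *s unit_tensor \<kappa>" for \<kappa>
    by (simp add: vec_eq_iff axis_def)
  have linG: "Vector_Spaces.linear (*s) (*s) ?G"
    by (simp add: linear_scaling_iff vec_eq_iff algebra_simps)
  have "(\<forall>w. f (?G w) = ?G (f w)) \<longleftrightarrow> (\<forall>\<kappa>. f (?G (unit_tensor \<kappa>)) = ?G (f (unit_tensor \<kappa>)))"
  proof
    assume "\<forall>\<kappa>. f (?G (unit_tensor \<kappa>)) = ?G (f (unit_tensor \<kappa>))"
    then have "f \<circ> ?G = ?G \<circ> f"
      by (intro linear_eq_on_axes Vector_Spaces.linear_compose[OF linG lin]
          Vector_Spaces.linear_compose[OF lin linG]) (simp only: comp_apply)
    then show "\<forall>w. f (?G w) = ?G (f w)"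
      unfolding fun_eq_iff by (simp only: comp_apply) blast
  qed blast
  also have "\<dots> \<longleftrightarrow> (\<forall>\<iota> \<kappa>. \<zeta> powi weight \<kappa> * f (unit_tensor \<kappa>) $ \<iota> = \<zeta> powi weight \<iota> * f (unit_tensor \<kappa>) $ \<iota>)"
    unfolding G1 scale vec_eq_iff by (simp only: vector_smult_component vec_lambda_beta) blast
  also have "\<dots> \<longleftrightarrow> (\<forall>\<iota> \<kappa>. f (unit_tensor \<kappa>) $ \<iota> \<noteq> 0 \<longrightarrow> [weight \<iota> = weight \<kappa>] (mod 2 * int n))"
  proof -
    have "\<zeta> powi weight \<kappa> * f (unit_tensor \<kappa>) $ \<iota> = \<zeta> powi weight \<iota> * f (unit_tensor \<kappa>) $ \<iota> \<longleftrightarrow>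
      (f (unit_tensor \<kappa>) $ \<iota> \<noteq> 0 \<longrightarrow> [weight \<iota> = weight \<kappa>] (mod 2 * int n))" for \<iota> \<kappa>
      using primitive_root_powi_eq_iff[OF \<zeta>, of "weight \<kappa>" "weight \<iota>"] n
      by (auto simp: cong_sym_eq[of "weight \<iota>"])
    then show ?thesis by blast
  qed
  finally have rot: "(\<forall>w. f (?G w) = ?G (f w)) \<longleftrightarrow>
    (\<forall>\<iota> \<kappa>. f (unit_tensor \<kappa>) $ \<iota> \<noteq> 0 \<longrightarrow> [weight \<iota> = weight \<kappa>] (mod 2 * int n))" .
  have "(\<forall>w. f (\<i> ^ CARD('k) *s reflect w) = \<i> ^ CARD('k) *s reflect (f w)) \<longleftrightarrow>
      (\<forall>w. f (reflect w) = reflect (f w))"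
    unfolding scale by (simp add: vec_eq_iff)
  then show ?thesis
    unfolding centralizer_algebra_def mem_Collect_eq commutes_with_binary_dihedral_iff[OF z(1)]
      tensor_power_rotation[OF z(2)] tensor_power_dihedral_flip rot
    using lin by blast
qed (simp add: centralizer_algebra_def)

lemma endomorphism_algebra_centralizer: "endomorphism_algebra (centralizer_algebra \<zeta> :: ('k::finite tensor \<Rightarrow> _) set)"
proof -
  have "Vector_Spaces.linear (*s) (*s) (tensor_power x :: 'k tensor \<Rightarrow> 'k tensor)" for x
    unfolding tensor_power_def by (rule matrix_vector_mul_linear_gen)
  then have "tensor_power x (u + v) = tensor_power x u + tensor_power x v"
    "tensor_power x (c *s u) = c *s tensor_power x u" for x c and u v :: "'k tensor"
    unfolding linear_scaling_iff by blast+
  then show ?thesis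
    unfolding endomorphism_algebra_def centralizer_algebra_def linear_scaling_iff
    by (simp add: vec.scale_right_distrib vector_smult_assoc mult.commute add_ac)
qed

text \<open>
  The sum of the elementary matrices at the positions \<open>(\<iota>, \<kappa>)\<close> and \<open>(flip \<iota>, flip \<kappa>)\<close>. Those
  with congruent weights of \<open>\<iota>\<close> and \<open>\<kappa>\<close> span the centralizer algebra.
\<close>

definition orbit_unit :: "('k::finite \<Rightarrow> 2) \<Rightarrow> ('k \<Rightarrow> 2) \<Rightarrow> 'k tensor \<Rightarrow> 'k tensor" where
  "orbit_unit \<iota> \<kappa> w = w $ \<kappa> *s unit_tensor \<iota> + w $ flip \<kappa> *s unit_tensor (flip \<iota>)"

lemma orbit_unit_flip [simp]: "orbit_unit (flip \<iota>) (flip \<kappa>) = orbit_unit \<iota> \<kappa>"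
  by (rule ext) (simp add: orbit_unit_def add.commute)

lemma orbit_unit_in_centralizer:
  assumes "primitive_root_of_unity (2 * n) \<zeta>" "n > 0" "[weight \<iota> = weight \<kappa>] (mod 2 * int n)"
  shows "orbit_unit \<iota> \<kappa> \<in> centralizer_algebra \<zeta>"
  unfolding centralizer_algebra_iff[OF assms(1,2)]
proof (intro conjI allI impI)
  show "Vector_Spaces.linear (*s) (*s) (orbit_unit \<iota> \<kappa>)"
    by (simp add: linear_scaling_iff orbit_unit_def vec.scale_left_distrib vec.scale_right_distrib
        vector_smult_assoc add_ac)
  show "orbit_unit \<iota> \<kappa> (reflect w) = reflect (orbit_unit \<iota> \<kappa> w)" for w
    by (simp add: orbit_unit_def) (simp add: reflect_def add.commute)
next
  fix \<alpha> \<beta> assume "orbit_unit \<iota> \<kappa> (unit_tensor \<beta>) $ \<alpha> \<noteq> 0"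
  then have "\<beta> = \<kappa> \<and> \<alpha> = \<iota> \<or> \<beta> = flip \<kappa> \<and> \<alpha> = flip \<iota>"
    by (auto simp: orbit_unit_def axis_def split: if_splits)
  moreover have "[- weight \<iota> = - weight \<kappa>] (mod 2 * int n)"
    using assms(3) by (simp add: cong_minus_minus_iff)
  ultimately show "[weight \<alpha> = weight \<beta>] (mod 2 * int n)"
    using assms(3) by auto
qed

section \<open>The submodules of tensor space\<close>

lemma centralizer_expansion:
  fixes f :: "'k::finite tensor \<Rightarrow> 'k tensor"
  assumes "primitive_root_of_unity (2 * n) \<zeta>" "n > 0" "f \<in> centralizer_algebra \<zeta>"
  shows "f (unit_tensor \<kappa>) =
    (\<Sum>\<iota> | [weight \<iota> = weight \<kappa>] (mod 2 * int n). f (unit_tensor \<kappa>) $ \<iota> *s unit_tensor \<iota>)"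
proof -
  have "f (unit_tensor \<kappa>) = (\<Sum>\<iota>\<in>UNIV. f (unit_tensor \<kappa>) $ \<iota> *s unit_tensor \<iota>)"
    by (rule basis_expansion[symmetric])
  also have "\<dots> = (\<Sum>\<iota> | [weight \<iota> = weight \<kappa>] (mod 2 * int n). f (unit_tensor \<kappa>) $ \<iota> *s unit_tensor \<iota>)"
    using assms(3)[unfolded centralizer_algebra_iff[OF assms(1,2)]]
    by (intro sum.mono_neutral_right) auto
  finally show ?thesis .
qed

text \<open>
  If \<open>l\<close> and \<open>-l\<close> are distinct modulo \<open>2 n\<close>, reflecting leaves the weight space of \<open>l\<close>, and
  \<open>orbit_unit\<close> restricts to it as a matrix unit.
\<close>

lemma irreducible_weight_space:
  fixes J :: "('k::finite \<Rightarrow> 2) set"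
  assumes \<zeta>: "primitive_root_of_unity (2 * n) \<zeta>" "n > 0"
    and J: "J = {\<iota>. [weight \<iota> = l] (mod 2 * int n)}" "J \<noteq> {}" and l: "\<not> [l = - l] (mod 2 * int n)"
  shows "irreducible_module (centralizer_algebra \<zeta>) (*s) (vec.span (unit_tensor ` J)) eval_action"
    and "vec.dim (vec.span (unit_tensor ` J)) = card J"
proof -
  have same: "[weight \<iota> = weight \<kappa>] (mod 2 * int n) \<longleftrightarrow> \<iota> \<in> J" if "\<kappa> \<in> J" for \<iota> \<kappa>
    using that by (simp add: J(1) cong_def)
  have noflip: "flip \<kappa> \<notin> J" if "\<kappa> \<in> J" for \<kappa>
  proof
    assume "flip \<kappa> \<in> J"
    then have "[- weight \<kappa> = l] (mod 2 * int n)" by (simp add: J(1))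
    moreover have "[- weight \<kappa> = - l] (mod 2 * int n)"
      using that by (simp add: J(1) cong_minus_minus_iff)
    ultimately show False using l by (simp add: cong_def)
  qed
  have nonzero: "unit_tensor t \<noteq> 0" if "t \<in> J" for t
    by (simp add: axis_eq_0_iff)
  have stable: "z (unit_tensor t) \<in> vec.span (unit_tensor ` J)"
    if "z \<in> centralizer_algebra \<zeta>" "t \<in> J" for z t
    by (subst centralizer_expansion[OF \<zeta> that(1)], rule vec.span_sum) (auto simp: same[OF that(2)] intro!: vec.span_scale intro: vec.span_base)
  have units: "\<exists>z\<in>centralizer_algebra \<zeta>. \<forall>q\<in>J. z (unit_tensor q) = (if q = t then unit_tensor s else 0)"
    if st: "s \<in> J" "t \<in> J" for s t
  proof
    show "orbit_unit s t \<in> centralizer_algebra \<zeta>"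
      using same st by (intro orbit_unit_in_centralizer[OF \<zeta>]) simp
    have "q \<noteq> flip t" if "q \<in> J" for q using noflip st(2) that by blast
    then show "\<forall>q\<in>J. orbit_unit s t (unit_tensor q) = (if q = t then unit_tensor s else 0)"
      by (auto simp: orbit_unit_def axis_def)
  qed
  show "irreducible_module (centralizer_algebra \<zeta>) (*s) (vec.span (unit_tensor ` J)) eval_action"
    by (rule irreducible_by_matrix_units(1)[where Z = "centralizer_algebra \<zeta>" and b = "unit_tensor" and J = J])
      (fact endomorphism_algebra_centralizer finite J(2) nonzero stable units)+
  show "vec.dim (vec.span (unit_tensor ` J)) = card J"
    by (rule irreducible_by_matrix_units(2)[where Z = "centralizer_algebra \<zeta>" and b = "unit_tensor" and J = J])
      (fact endomorphism_algebra_centralizer finite J(2) nonzero stable units)+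
qed

definition folded_tensor :: "complex \<Rightarrow> ('k::finite \<Rightarrow> 2) \<Rightarrow> 'k tensor" where
  "folded_tensor \<epsilon> \<iota> = unit_tensor \<iota> + \<epsilon> *s unit_tensor (flip \<iota>)"

lemma folded_tensor_flip:
  assumes "\<epsilon> * \<epsilon> = 1"
  shows "folded_tensor \<epsilon> (flip \<iota>) = \<epsilon> *s folded_tensor \<epsilon> \<iota>"
  using assms by (simp add: folded_tensor_def vec.scale_right_distrib vector_smult_assoc add.commute)

lemma folded_tensor_nonzero: "folded_tensor \<epsilon> \<iota> \<noteq> 0"
proof
  assume "folded_tensor \<epsilon> \<iota> = 0"
  then have "folded_tensor \<epsilon> \<iota> $ \<iota> = 0" by simp
  then show False by (simp add: folded_tensor_def axis_def)
qed

text \<open>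
  If \<open>l\<close> and \<open>-l\<close> agree modulo \<open>2 n\<close>, the weight space of \<open>l\<close> is stable under \<open>reflect\<close> and splits
  into the two eigenspaces of \<open>reflect\<close>; a set \<open>J\<close> of representatives of the flip orbits indexes
  a basis of each.
\<close>

lemma irreducible_folded_space:
  fixes J :: "('k::finite \<Rightarrow> 2) set"
  assumes \<zeta>: "primitive_root_of_unity (2 * n) \<zeta>" "n > 0" and \<epsilon>: "\<epsilon> * \<epsilon> = 1"
    and J: "\<And>\<iota>. \<iota> \<in> J \<Longrightarrow> [weight \<iota> = l] (mod 2 * int n)" "J \<noteq> {}"
      "\<And>\<iota>. \<iota> \<in> J \<Longrightarrow> flip \<iota> \<notin> J" "\<And>\<iota>. [weight \<iota> = l] (mod 2 * int n) \<Longrightarrow> \<iota> \<in> J \<or> flip \<iota> \<in> J"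
  shows "irreducible_module (centralizer_algebra \<zeta>) (*s) (vec.span (folded_tensor \<epsilon> ` J)) eval_action"
    and "vec.dim (vec.span (folded_tensor \<epsilon> ` J)) = card J"
proof -
  have nonzero: "folded_tensor \<epsilon> t \<noteq> 0" if "t \<in> J" for t
    by (rule folded_tensor_nonzero)
  have stable: "z (folded_tensor \<epsilon> t) \<in> vec.span (folded_tensor \<epsilon> ` J)"
    if z: "z \<in> centralizer_algebra \<zeta>" and t: "t \<in> J" for z t
  proof -
    let ?S = "{\<iota> :: 'k \<Rightarrow> 2. [weight \<iota> = weight t] (mod 2 * int n)}"
    have z': "z (x + y) = z x + z y" "z (c *s x) = c *s z x" "z (reflect x) = reflect (z x)" for x y c
      using z by (simp_all add: centralizer_algebra_iff[OF \<zeta>] linear_scaling_iff)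
    have refl_sum: "reflect (\<Sum>\<iota>\<in>S. c \<iota> *s unit_tensor \<iota>) = (\<Sum>\<iota>\<in>S. c \<iota> *s unit_tensor (flip \<iota>))"
      if "finite S" for S c
      using that
    proof (induction S)
      case empty
      show ?case by (simp add: reflect_def vec_eq_iff)
    qed simp
    have "z (folded_tensor \<epsilon> t) = z (unit_tensor t) + \<epsilon> *s reflect (z (unit_tensor t))"
      by (simp add: folded_tensor_def z' flip: z'(3))
    also have "\<dots> = (\<Sum>\<iota>\<in>?S. z (unit_tensor t) $ \<iota> *s folded_tensor \<epsilon> \<iota>)"
      by (subst (1 2) centralizer_expansion[OF \<zeta> z, of t])
        (simp add: refl_sum folded_tensor_def vec.scale_right_distrib sum.distrib vec.scale_sum_right
          vector_smult_assoc mult.commute)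
    also have "\<dots> \<in> vec.span (folded_tensor \<epsilon> ` J)"
    proof (intro vec.span_sum vec.span_scale)
      fix \<iota> assume "\<iota> \<in> ?S"
      then have "[weight \<iota> = l] (mod 2 * int n)" using J(1)[OF t] by (simp add: cong_def)
      then consider "\<iota> \<in> J" | "flip \<iota> \<in> J" using J(4) by blast
      then show "folded_tensor \<epsilon> \<iota> \<in> vec.span (folded_tensor \<epsilon> ` J)"
      proof cases
        case 2
        have "folded_tensor \<epsilon> \<iota> = \<epsilon> *s folded_tensor \<epsilon> (flip \<iota>)"
          using folded_tensor_flip[OF \<epsilon>, of "flip \<iota>"] by simp
        then show ?thesis using 2 by (auto intro: vec.span_scale vec.span_base)
      qed (auto intro: vec.span_base)
    qed
    finally show ?thesis .
  qed
  have units: "\<exists>z\<in>centralizer_algebra \<zeta>.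
      \<forall>q\<in>J. z (folded_tensor \<epsilon> q) = (if q = t then folded_tensor \<epsilon> s else 0)"
    if st: "s \<in> J" "t \<in> J" for s t
  proof
    have "[weight s = weight t] (mod 2 * int n)" using J(1)[OF st(1)] J(1)[OF st(2)] by (simp add: cong_def)
    then show "orbit_unit s t \<in> centralizer_algebra \<zeta>" by (intro orbit_unit_in_centralizer[OF \<zeta>])
    have "q \<noteq> flip t" "flip t \<noteq> q" "flip q \<noteq> t" "t \<noteq> flip q" "flip q = flip t \<longleftrightarrow> q = t"
      "flip t = flip q \<longleftrightarrow> q = t" if "q \<in> J" for q
      using J(3) st(2) that by (auto dest: arg_cong[of _ _ flip])
    then show "\<forall>q\<in>J. orbit_unit s t (folded_tensor \<epsilon> q) = (if q = t then folded_tensor \<epsilon> s else 0)"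
      by (auto simp: orbit_unit_def folded_tensor_def axis_def)
  qed
  show "irreducible_module (centralizer_algebra \<zeta>) (*s) (vec.span (folded_tensor \<epsilon> ` J)) eval_action"
    by (rule irreducible_by_matrix_units(1)[where Z = "centralizer_algebra \<zeta>" and b = "folded_tensor \<epsilon>" and J = J])
      (fact endomorphism_algebra_centralizer finite J(2) nonzero stable units)+
  show "vec.dim (vec.span (folded_tensor \<epsilon> ` J)) = card J"
    by (rule irreducible_by_matrix_units(2)[where Z = "centralizer_algebra \<zeta>" and b = "folded_tensor \<epsilon>" and J = J])
      (fact endomorphism_algebra_centralizer finite J(2) nonzero stable units)+
qed

section \<open>Every irreducible module occurs\<close>

lemma orbit_unit_diagonal_idempotent: "orbit_unit \<iota> \<iota> \<circ> orbit_unit \<iota> \<iota> = orbit_unit \<iota> \<iota>"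
  by (rule ext) (simp add: orbit_unit_def axis_def)

text \<open>
  The image of \<open>orbit_unit \<iota> \<iota>\<close> is spanned by two tensors of incongruent weights, so an element of
  the algebra acts on it diagonally, and by the same scalar twice because it commutes with \<open>reflect\<close>.
\<close>

lemma minimal_orbit_unit:
  fixes \<iota> :: "'k::finite \<Rightarrow> 2"
  assumes \<zeta>: "primitive_root_of_unity (2 * n) \<zeta>" "n > 0"
    and w: "\<not> [weight \<iota> = - weight \<iota>] (mod 2 * int n)"
    and z: "z \<in> centralizer_algebra \<zeta>"
  shows "\<exists>c. orbit_unit \<iota> \<iota> \<circ> z \<circ> orbit_unit \<iota> \<iota> = (\<lambda>w. c *s orbit_unit \<iota> \<iota> w)"
proof
  let ?c = "z (unit_tensor \<iota>) $ \<iota>"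
  have z': "z (x + y) = z x + z y" "z (c *s x) = c *s z x" "z (reflect x) = reflect (z x)"
      "z (unit_tensor \<kappa>) $ \<alpha> \<noteq> 0 \<Longrightarrow> [weight \<alpha> = weight \<kappa>] (mod 2 * int n)" for x y c \<alpha> \<kappa>
    using z by (simp_all add: centralizer_algebra_iff[OF \<zeta>] linear_scaling_iff)
  have "z (unit_tensor \<iota>) $ flip \<iota> = 0"
    using z'(4)[of \<iota> "flip \<iota>"] w cong_sym by fastforce
  moreover have "z (unit_tensor (flip \<iota>)) = reflect (z (unit_tensor \<iota>))"
    using z'(3)[of "unit_tensor \<iota>"] by simp
  ultimately show "orbit_unit \<iota> \<iota> \<circ> z \<circ> orbit_unit \<iota> \<iota> = (\<lambda>w. ?c *s orbit_unit \<iota> \<iota> w)"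
    by (simp add: fun_eq_iff orbit_unit_def z' reflect_def vec.scale_right_distrib vector_smult_assoc
        mult.commute)
qed

text \<open>
  For \<open>\<epsilon>\<close> equal to \<open>1\<close> and \<open>-1\<close> these are projections of rank one with sum \<open>orbit_unit \<iota> \<iota>\<close>; they
  split it when \<open>\<iota>\<close> and \<open>flip \<iota>\<close> have congruent weights.
\<close>

definition folded_projection :: "complex \<Rightarrow> ('k::finite \<Rightarrow> 2) \<Rightarrow> 'k tensor \<Rightarrow> 'k tensor" where
  "folded_projection \<epsilon> \<iota> w = ((w $ \<iota> + \<epsilon> * w $ flip \<iota>) / 2) *s folded_tensor \<epsilon> \<iota>"

lemma folded_projection_flip:
  assumes "\<epsilon> * \<epsilon> = 1"
  shows "folded_projection \<epsilon> (flip \<iota>) = folded_projection \<epsilon> \<iota>"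
proof
  fix w
  have "(w $ flip \<iota> + \<epsilon> * w $ \<iota>) * \<epsilon> = w $ \<iota> + \<epsilon> * w $ flip \<iota>"
    using assms by (simp add: algebra_simps)
  then show "folded_projection \<epsilon> (flip \<iota>) w = folded_projection \<epsilon> \<iota> w"
    by (simp add: folded_projection_def folded_tensor_flip[OF assms] vector_smult_assoc)
qed

lemma folded_projection_folded_tensor [simp]:
  assumes "\<epsilon> * \<epsilon> = 1"
  shows "folded_projection \<epsilon> \<iota> (folded_tensor \<epsilon> \<iota>) = folded_tensor \<epsilon> \<iota>"
  using assms by (simp add: folded_projection_def folded_tensor_def axis_def)

lemma folded_projection_scale:
  "folded_projection \<epsilon> \<iota> (c *s x) = c *s folded_projection \<epsilon> \<iota> x"
  by (simp add: folded_projection_def vector_smult_assoc algebra_simps)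

lemma folded_projection_idempotent:
  assumes "\<epsilon> * \<epsilon> = 1"
  shows "folded_projection \<epsilon> \<iota> \<circ> folded_projection \<epsilon> \<iota> = folded_projection \<epsilon> \<iota>"
proof
  fix w
  show "(folded_projection \<epsilon> \<iota> \<circ> folded_projection \<epsilon> \<iota>) w = folded_projection \<epsilon> \<iota> w"
    using folded_projection_folded_tensor[OF assms, of \<iota>]
    by (simp add: folded_projection_def[of \<epsilon> \<iota> w] folded_projection_scale)
qed

text \<open>
  Compressing any linear map by a projection of rank one gives a multiple of the projection.
\<close>

lemma minimal_folded_projection:
  assumes "Vector_Spaces.linear (*s) (*s) z"
  shows "\<exists>c. folded_projection \<epsilon> \<iota> \<circ> z \<circ> folded_projection \<epsilon> \<iota> = (\<lambda>w. c *s folded_projection \<epsilon> \<iota> w)"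
proof -
  have "(folded_projection \<epsilon> \<iota> \<circ> z \<circ> folded_projection \<epsilon> \<iota>) w =
      (let x = z (folded_tensor \<epsilon> \<iota>) in (x $ \<iota> + \<epsilon> * x $ flip \<iota>) / 2) *s folded_projection \<epsilon> \<iota> w" for w
    using assms
    by (simp add: linear_scaling_iff folded_projection_def[of _ _ w] folded_projection_scale)
      (simp add: folded_projection_def vector_smult_assoc Let_def)
  then show ?thesis unfolding fun_eq_iff by blast
qed

lemma folded_projection_eq:
  assumes "\<epsilon> * \<epsilon> = 1"
  shows "folded_projection \<epsilon> \<iota> w =
    (1 / 2) *s orbit_unit \<iota> \<iota> w + (\<epsilon> / 2) *s orbit_unit \<iota> (flip \<iota>) w"
  using assms
  by (simp add: folded_projection_def folded_tensor_def orbit_unit_def vec_eq_iff algebra_simps add_divide_distrib)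

lemma folded_projection_in_centralizer:
  assumes \<zeta>: "primitive_root_of_unity (2 * n) \<zeta>" "n > 0" and \<epsilon>: "\<epsilon> * \<epsilon> = 1"
    and w: "[weight \<iota> = - weight \<iota>] (mod 2 * int n)"
  shows "folded_projection \<epsilon> \<iota> \<in> centralizer_algebra \<zeta>"
proof -
  note A = endomorphism_algebraD[OF endomorphism_algebra_centralizer]
  have "orbit_unit \<iota> \<iota> \<in> centralizer_algebra \<zeta>" "orbit_unit \<iota> (flip \<iota>) \<in> centralizer_algebra \<zeta>"
    using w by (auto intro!: orbit_unit_in_centralizer[OF \<zeta>])
  then have "(\<lambda>w. (1 / 2) *s orbit_unit \<iota> \<iota> w + (\<epsilon> / 2) *s orbit_unit \<iota> (flip \<iota>) w) \<in> centralizer_algebra \<zeta>"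
    by (intro A(2) A(4))
  then show ?thesis by (simp add: folded_projection_eq[OF \<epsilon>, symmetric])
qed

text \<open>
  The identity is half the sum of the \<open>orbit_unit \<iota> \<iota>\<close>, so one of these acts nontrivially on a given
  nonzero module.
\<close>

lemma orbit_unit_acts_nontrivially:
  fixes \<zeta> and sc :: "complex \<Rightarrow> 'm::ab_group_add \<Rightarrow> 'm"
  assumes \<zeta>: "primitive_root_of_unity (2 * n) \<zeta>" "n > 0"
    and M: "algebra_module (centralizer_algebra \<zeta> :: ('k::finite tensor \<Rightarrow> _) set) sc U \<rho>"
    and u: "u \<in> U" "u \<noteq> 0"
  shows "\<exists>\<iota> :: 'k \<Rightarrow> 2. \<rho> (orbit_unit \<iota> \<iota>) u \<noteq> 0"
proof (rule ccontr)
  assume "\<not> ?thesis"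
  then have zero: "\<rho> (orbit_unit \<iota> \<iota>) u = 0" for \<iota> :: "'k \<Rightarrow> 2" by blast
  interpret vector_space sc by (rule algebra_moduleD(1)[OF M])
  note A = endomorphism_algebra_centralizer[where 'k = 'k and \<zeta> = \<zeta>]
  have mem: "orbit_unit \<iota> \<iota> \<in> centralizer_algebra \<zeta>" for \<iota> :: "'k \<Rightarrow> 2"
    by (rule orbit_unit_in_centralizer[OF \<zeta>]) simp
  let ?s = "\<lambda>w :: 'k tensor. \<Sum>\<iota>\<in>UNIV. orbit_unit \<iota> \<iota> w"
  have s: "?s \<in> centralizer_algebra \<zeta>"
    using endomorphism_algebra_sum[OF A, of UNIV "\<lambda>\<iota>. orbit_unit \<iota> \<iota>"] mem by blast
  have "(\<Sum>\<iota>\<in>UNIV. w $ flip \<iota> *s unit_tensor (flip \<iota>)) = (\<Sum>\<iota>\<in>UNIV. w $ \<iota> *s unit_tensor \<iota>)" for w :: "'k tensor"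
    by (rule sum.reindex_bij_betw[OF bij_flip])
  then have "?s w = 2 *s w" for w
    by (simp add: orbit_unit_def sum.distrib basis_expansion vec_eq_iff)
  then have "(\<lambda>w. (1 / 2) *s ?s w) = id" by (simp add: fun_eq_iff vector_smult_assoc)
  then have "u = sc (1 / 2) (\<rho> ?s u)"
    using algebra_moduleD(7)[OF M s u(1), of "1 / 2"] algebra_moduleD(9)[OF M u(1)] by simp
  also have "\<rho> ?s u = 0"
    using algebra_module_sum[OF A M u(1), of UNIV "\<lambda>\<iota>. orbit_unit \<iota> \<iota>"] mem zero by simp
  finally show False using u(2) by simp
qed

lemma folded_projection_acts_nontrivially:
  assumes \<zeta>: "primitive_root_of_unity (2 * n) \<zeta>" "n > 0"
    and M: "algebra_module (centralizer_algebra \<zeta>) sc U \<rho>"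
    and u: "u \<in> U" "\<rho> (orbit_unit \<iota> \<iota>) u \<noteq> 0"
    and w: "[weight \<iota> = - weight \<iota>] (mod 2 * int n)"
  shows "\<exists>\<epsilon>\<in>{1, -1}. \<rho> (folded_projection \<epsilon> \<iota>) u \<noteq> 0"
proof (rule ccontr)
  assume "\<not> ?thesis"
  then have zero: "\<rho> (folded_projection 1 \<iota>) u = 0" "\<rho> (folded_projection (-1) \<iota>) u = 0" by auto
  have mem: "folded_projection 1 \<iota> \<in> centralizer_algebra \<zeta>" "folded_projection (-1) \<iota> \<in> centralizer_algebra \<zeta>"
    using w by (auto intro!: folded_projection_in_centralizer[OF \<zeta>])
  have "(\<lambda>w. folded_projection 1 \<iota> w + folded_projection (-1) \<iota> w) = orbit_unit \<iota> \<iota>"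
    by (rule ext) (simp add: folded_projection_eq vec_eq_iff)
  then have "\<rho> (orbit_unit \<iota> \<iota>) u = 0"
    using algebra_moduleD(6)[OF M mem u(1)] zero by simp
  then show False using u(2) by simp
qed

section \<open>Sign sequences\<close>

definition sign_of :: "('k \<Rightarrow> 2) \<Rightarrow> 'k \<Rightarrow> int" where
  "sign_of \<iota> = (\<lambda>j. if \<iota> j = 1 then - 1 else 1)"

lemma sign_of_flip: "sign_of (flip \<iota>) = - sign_of \<iota>"
  by (auto simp: sign_of_def flip_def fun_eq_iff)

lemma sign_of_eq_iff: "sign_of \<iota> = sign_of \<kappa> \<longleftrightarrow> \<iota> = \<kappa>"
proof
  assume eq: "sign_of \<iota> = sign_of \<kappa>"
  show "\<iota> = \<kappa>"
  proof
    fix j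
    have "sign_of \<iota> j = sign_of \<kappa> j" by (simp add: eq)
    then show "\<iota> j = \<kappa> j"
      using exhaust_2[of "\<iota> j"] exhaust_2[of "\<kappa> j"] by (auto simp: sign_of_def split: if_splits)
  qed
qed simp

lemma signs_eq_range: "signs = range (sign_of :: ('k \<Rightarrow> 2) \<Rightarrow> _)"
proof
  show "signs \<subseteq> range (sign_of :: ('k \<Rightarrow> 2) \<Rightarrow> _)"
  proof
    fix r :: "'k \<Rightarrow> int" assume "r \<in> signs"
    then have "r = sign_of (\<lambda>j. if r j = - 1 then 1 else 2)"
      by (auto simp: signs_def sign_of_def fun_eq_iff)
    then show "r \<in> range sign_of" by blast
  qed
qed (auto simp: signs_def sign_of_def split: if_splits)

lemma minus_count_sign_of: "minus_count (sign_of \<iota>) = card {j. \<iota> j = 1}"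
  by (simp add: minus_count_def sign_of_def)

lemma vtensor_sign_of: "vtensor (sign_of \<iota>) = unit_tensor (\<iota> :: 'k::finite \<Rightarrow> 2)"
proof -
  have entry: "vbasis (sign_of \<iota> j) $ a = (if a = \<iota> j then 1 else 0)" for j a
    using exhaust_2[of a] exhaust_2[of "\<iota> j"] by (auto simp: vbasis_def sign_of_def vector_def)
  have "(\<Prod>j\<in>UNIV. vbasis (sign_of \<iota> j) $ \<kappa> j) = (if \<kappa> = \<iota> then 1 else 0)" for \<kappa>
  proof (cases "\<kappa> = \<iota>")
    case False
    then obtain j where "\<kappa> j \<noteq> \<iota> j" by blast
    then have "\<exists>j\<in>UNIV. vbasis (sign_of \<iota> j) $ \<kappa> j = 0"
      by (intro bexI[of _ j]) (simp_all add: entry)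
    then show ?thesis using False by (simp add: prod_zero_iff)
  qed (simp add: entry)
  then show ?thesis
    by (simp add: vtensor_def pure_tensor_def vec_eq_iff axis_def)
qed

text \<open>
  Lexicographic comparison is total here because the positions form a finite linear order.
\<close>

lemma sign_gt_total:
  fixes r s :: "'k::{finite,linorder} \<Rightarrow> int"
  assumes "r \<noteq> s"
  shows "sign_gt r s \<longleftrightarrow> \<not> sign_gt s r"
  using assms less_fun_trichotomy[of r s] less_fun_asym[of r s]
  by (auto simp: sign_gt_def sign_ge_def)

definition module_index :: "nat \<Rightarrow> nat \<Rightarrow> ('k::{finite,linorder} \<Rightarrow> 2) set" where
  "module_index n l = {\<iota>. sign_of \<iota> \<in> K n l}"

lemma K_eq_image: "K n l = sign_of ` module_index n l"
  by (auto simp: module_index_def K_def signs_eq_range)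

lemma mem_module_index_iff:
  "\<iota> \<in> module_index n l \<longleftrightarrow> [weight \<iota> = int l] (mod 2 * int n) \<and>
     (l \<in> {0, n} \<longrightarrow> sign_gt (sign_of \<iota>) (sign_of (flip \<iota>)))"
  by (auto simp: module_index_def K_def signs_eq_range weight_def minus_count_sign_of sign_of_flip)

lemma Zmod_eq: "Zmod n l = vec.span (unit_tensor ` module_index n l)"
  unfolding Zmod_def K_eq_image Setcompr_eq_image image_image vtensor_sign_of ..

lemma Zmod_plus_eq:
  "(Zmod_plus n l :: 'k::{finite,linorder} tensor set) =
     vec.span (folded_tensor (\<i> powi (int l - int CARD('k))) ` module_index n l)"
  unfolding Zmod_plus_def K_eq_image
    Setcompr_eq_image image_image vtensor_sign_of folded_tensor_def sign_of_flip[symmetric]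
  by simp

lemma Zmod_minus_eq:
  "(Zmod_minus n l :: 'k::{finite,linorder} tensor set) =
     vec.span (folded_tensor (- (\<i> powi (int l - int CARD('k)))) ` module_index n l)"
  unfolding Zmod_minus_def K_eq_image
    Setcompr_eq_image image_image vtensor_sign_of folded_tensor_def sign_of_flip[symmetric]
  by simp

lemma self_dual_label:
  assumes "l \<in> {0, n}"
  shows "[int l = - int l] (mod 2 * int n)"
  using assms by (auto simp: cong_iff_dvd_diff)

lemma not_self_dual_label:
  assumes "l \<in> {1..n - 1}"
  shows "\<not> [int l = - int l] (mod 2 * int n)"
proof
  assume "[int l = - int l] (mod 2 * int n)"
  then have "int n dvd int l" by (simp add: cong_iff_dvd_diff flip: mult_2)
  then have "n \<le> l" using assms by (simp add: dvd_imp_le)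
  then show False using assms unfolding atLeastAtMost_iff by linarith
qed

text \<open>
  For a label congruent to its negative, \<open>r\<close> and \<open>-r\<close> lie in the same weight class, and the total order
  picks one of the two.
\<close>

lemma flip_module_index_iff:
  assumes "l \<in> {0, n}" "[weight \<iota> = int l] (mod 2 * int n)"
  shows "flip \<iota> \<in> module_index n l \<longleftrightarrow> \<iota> \<notin> module_index n l"
proof -
  have "[weight (flip \<iota>) = int l] (mod 2 * int n)"
    using assms(2) self_dual_label[OF assms(1)]
    by (metis cong_minus_minus_iff cong_sym cong_trans weight_flip)
  moreover have "sign_of (flip \<iota>) \<noteq> sign_of \<iota>" by (simp add: sign_of_eq_iff)
  ultimately show ?thesis
    using assms sign_gt_total by (auto simp: mem_module_index_iff)
qed

section \<open>Dimensions\<close>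

lemma weight_cong_iff:
  fixes a b k n :: nat
  shows "[int k - 2 * int b = int k - 2 * int a] (mod 2 * int n) \<longleftrightarrow> [b = a] (mod n)"
proof -
  have "[int k - 2 * int b = int k - 2 * int a] (mod 2 * int n) \<longleftrightarrow> 2 * int n dvd 2 * (int a - int b)"
    by (simp add: cong_iff_dvd_diff algebra_simps)
  also have "\<dots> \<longleftrightarrow> [int a = int b] (mod int n)"
    unfolding cong_iff_dvd_diff dvd_mult_cancel_left by simp
  finally show ?thesis by (simp add: cong_int_iff cong_sym_eq)
qed

lemma card_with_ones: "card {\<iota> :: 'k::finite \<Rightarrow> 2. card {j. \<iota> j = 1} = b} = CARD('k) choose b"
proof -
  have "bij_betw (\<lambda>\<iota>. {j. \<iota> j = 1}) {\<iota> :: 'k \<Rightarrow> 2. card {j. \<iota> j = 1} = b} {B. B \<subseteq> UNIV \<and> card B = b}"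
  proof (rule bij_betw_byWitness[where f' = "\<lambda>B j. if j \<in> B then 1 else 2"])
    show "\<forall>\<iota>\<in>{\<iota> :: 'k \<Rightarrow> 2. card {j. \<iota> j = 1} = b}. (\<lambda>j. if j \<in> {j. \<iota> j = 1} then 1 else 2) = \<iota>"
    proof (intro ballI ext)
      fix \<iota> :: "'k \<Rightarrow> 2" and j
      show "(if j \<in> {j. \<iota> j = 1} then 1 else 2) = \<iota> j" using exhaust_2[of "\<iota> j"] by auto
    qed
  qed auto
  from bij_betw_same_card[OF this] show ?thesis
    using n_subsets[of "UNIV :: 'k set" b] by simp
qed

lemma a_min_properties:
  assumes "l \<in> \<Lambda> n k"
  shows "a_min n k l \<le> k" "[int l = int k - 2 * int (a_min n k l)] (mod 2 * int n)"
proof -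
  have "\<exists>a. a \<in> {0..k} \<and> [int l = int k - 2 * int a] (mod 2 * int n)"
    using assms by (auto simp: \<Lambda>_def)
  from LeastI_ex[OF this, folded a_min_def]
  show "a_min n k l \<le> k" "[int l = int k - 2 * int (a_min n k l)] (mod 2 * int n)"
    unfolding atLeastAtMost_iff by blast+
qed

text \<open>
  A sequence with \<open>b\<close> negative signs has weight \<open>k - 2 b\<close>, so the sequences of a weight class are
  counted by the values of \<open>b\<close> in one residue class modulo \<open>n\<close>.
\<close>

lemma card_weight_class:
  assumes "l \<in> \<Lambda> n CARD('k::finite)"
  shows "card {\<iota> :: 'k \<Rightarrow> 2. [weight \<iota> = int l] (mod 2 * int n)} =
    (\<Sum>b | b \<le> CARD('k) \<and> [b = a_min n CARD('k) l] (mod n). CARD('k) choose b)"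
proof -
  let ?a = "a_min n CARD('k) l"
  let ?B = "{b. b \<le> CARD('k) \<and> [b = ?a] (mod n)}"
  have iff: "[weight \<iota> = int l] (mod 2 * int n) \<longleftrightarrow> [card {j. \<iota> j = 1} = ?a] (mod n)" for \<iota> :: "'k \<Rightarrow> 2"
    using a_min_properties(2)[OF assms] weight_cong_iff[of "CARD('k)" "card {j. \<iota> j = 1}" ?a n]
    unfolding weight_def by (simp add: cong_def)
  have "card {j. \<iota> j = 1} \<le> CARD('k)" for \<iota> :: "'k \<Rightarrow> 2" by (rule card_mono) simp_all
  then have "{\<iota> :: 'k \<Rightarrow> 2. [weight \<iota> = int l] (mod 2 * int n)} = (\<Union>b\<in>?B. {\<iota>. card {j. \<iota> j = 1} = b})"
    by (auto simp: iff)
  also have "card \<dots> = (\<Sum>b\<in>?B. card {\<iota> :: 'k \<Rightarrow> 2. card {j. \<iota> j = 1} = b})"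
  proof (rule card_UN_disjoint)
    show "finite ?B" by simp
    show "\<forall>b\<in>?B. finite {\<iota> :: 'k \<Rightarrow> 2. card {j. \<iota> j = 1} = b}" by simp
    show "\<forall>b\<in>?B. \<forall>c\<in>?B. b \<noteq> c \<longrightarrow>
      {\<iota> :: 'k \<Rightarrow> 2. card {j. \<iota> j = 1} = b} \<inter> {\<iota>. card {j. \<iota> j = 1} = c} = {}" by blast
  qed
  finally show ?thesis by (simp add: card_with_ones)
qed

lemma weight_class_nonempty:
  assumes "l \<in> \<Lambda> n CARD('k::finite)"
  shows "\<exists>\<iota> :: 'k \<Rightarrow> 2. [weight \<iota> = int l] (mod 2 * int n)"
proof -
  let ?a = "a_min n CARD('k) l"
  obtain B :: "'k set" where "card B = ?a"
    using obtain_subset_with_card_n[of ?a "UNIV :: 'k set"] a_min_properties(1)[OF assms] by metis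
  then have "weight (\<lambda>j. if j \<in> B then 1 else 2) = int CARD('k) - 2 * int ?a" by (simp add: weight_def)
  then show ?thesis using a_min_properties(2)[OF assms] by (metis cong_sym)
qed

lemma module_index_nonempty:
  assumes "l \<in> \<Lambda> n CARD('k::{finite,linorder})"
  shows "(module_index n l :: ('k \<Rightarrow> 2) set) \<noteq> {}"
proof -
  obtain \<iota> :: "'k \<Rightarrow> 2" where \<iota>: "[weight \<iota> = int l] (mod 2 * int n)"
    using weight_class_nonempty[OF assms] by blast
  show ?thesis
  proof (cases "l \<in> {0, n}")
    case True
    then show ?thesis using flip_module_index_iff[OF True \<iota>] by blast
  next
    case False
    then have "\<iota> \<in> module_index n l" using \<iota> by (simp add: mem_module_index_iff)
    then show ?thesis by blast
  qed
qed

lemma card_module_index_self_dual: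
  assumes "l \<in> {0, n}"
  shows "2 * card (module_index n l :: ('k::{finite,linorder} \<Rightarrow> 2) set) =
    card {\<iota> :: 'k \<Rightarrow> 2. [weight \<iota> = int l] (mod 2 * int n)}"
proof -
  let ?I = "module_index n l :: ('k \<Rightarrow> 2) set"
  have I: "[weight \<iota> = int l] (mod 2 * int n)" if "\<iota> \<in> ?I" for \<iota>
    using that by (simp add: mem_module_index_iff)
  have fl: "[weight (flip \<iota>) = int l] (mod 2 * int n)" if "[weight \<iota> = int l] (mod 2 * int n)" for \<iota> :: "'k \<Rightarrow> 2"
    using that self_dual_label[OF assms] by (metis cong_minus_minus_iff cong_sym cong_trans weight_flip)
  have "{\<iota> :: 'k \<Rightarrow> 2. [weight \<iota> = int l] (mod 2 * int n)} = ?I \<union> flip ` ?I" (is "?S = _")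
  proof (intro equalityI subsetI)
    fix \<iota> assume "\<iota> \<in> ?S"
    then have "\<iota> \<in> ?I \<or> flip \<iota> \<in> ?I" using flip_module_index_iff[OF assms] by blast
    then show "\<iota> \<in> ?I \<union> flip ` ?I" by (metis UnCI flip_flip imageI)
  qed (use I fl in blast)
  moreover have "?I \<inter> flip ` ?I = {}" using flip_module_index_iff[OF assms] I by blast
  moreover have "card (flip ` ?I) = card ?I"
    by (rule card_image) (metis flip_flip inj_onI)
  ultimately show ?thesis by (simp add: card_Un_disjoint)
qed

section \<open>Binomial coefficients modulo a cyclic relation\<close>

text \<open>
  Put \<open>y = z ^ n\<close> and \<open>b = n q + r\<close>; then \<open>y - 1\<close> divides \<open>(y ^ q - 1) z ^ r\<close>.
\<close>

lemma monom_minus_one_dvd: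
  "(monom 1 n - 1 :: 'a::idom poly) dvd monom 1 b - monom 1 (b mod n)"
proof -
  have "(monom 1 n - 1 :: 'a poly) dvd monom 1 n ^ (b div n) - 1"
    using power_diff_1_eq[of "monom 1 n :: 'a poly" "b div n"] by simp
  then have "(monom 1 n - 1 :: 'a poly) dvd (monom 1 n ^ (b div n) - 1) * monom 1 (b mod n)"
    by (rule dvd_mult2)
  also have "\<dots> = monom 1 b - monom 1 (b mod n)"
    by (simp add: left_diff_distrib monom_power mult_monom)
  finally show ?thesis .
qed

text \<open>
  Reducing each exponent of the binomial expansion modulo \<open>n\<close> gives a polynomial of degree below \<open>n\<close>
  in the same residue class, which is therefore the remainder.
\<close>

lemma cyclic_coeff_binomial:
  assumes "n > 0"
  shows "cyclic_coeff n ([:1, 1:] ^ k) a = of_nat (\<Sum>b | b \<le> k \<and> [b = a] (mod n). k choose b)"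
proof -
  let ?y = "monom 1 n - 1 :: complex poly"
  define q :: "complex poly" where "q = (\<Sum>b\<le>k. of_nat (k choose b) * monom 1 (b mod n))"
  have "degree (monom 1 n + (- 1) :: complex poly) = degree (monom 1 n :: complex poly)"
    using assms by (intro degree_add_eq_left) (simp add: degree_monom_eq)
  then have deg: "degree ?y = n" by (simp add: degree_monom_eq)
  have "[:1, 1:] ^ k = (monom 1 1 + 1 :: complex poly) ^ k" by (simp add: monom_altdef one_pCons)
  also have "\<dots> = (\<Sum>b\<le>k. of_nat (k choose b) * monom 1 b)"
    by (subst binomial_ring) (simp add: monom_power)
  finally have "[:1, 1:] ^ k - q = (\<Sum>b\<le>k. of_nat (k choose b) * (monom 1 b - monom 1 (b mod n)))"
    by (simp add: q_def right_diff_distrib sum_subtractf)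
  also have "?y dvd \<dots>" by (intro dvd_sum dvd_mult monom_minus_one_dvd)
  finally have "[:1, 1:] ^ k mod ?y = q mod ?y" by (simp add: mod_eq_dvd_iff)
  also have "q mod ?y = q"
  proof (rule mod_poly_less)
    have "degree (of_nat (k choose b) * monom 1 (b mod n) :: complex poly) < n" for b
      using assms by (simp add: of_nat_monom mult_monom) (metis degree_monom_le le_less_trans mod_less_divisor)
    then show "degree q < degree ?y"
      unfolding deg q_def using assms by (intro degree_sum_less)
  qed
  finally have "cyclic_coeff n ([:1, 1:] ^ k) a = coeff q (a mod n)" by (simp add: cyclic_coeff_def)
  also have "\<dots> = (\<Sum>b\<le>k. if [b = a] (mod n) then of_nat (k choose b) else 0)"
    unfolding q_def coeff_sum
    by (rule sum.cong) (simp_all add: of_nat_monom mult_monom cong_def)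
  also have "\<dots> = of_nat (\<Sum>b | b \<le> k \<and> [b = a] (mod n). k choose b)"
    by (simp flip: sum.inter_filter)
  finally show ?thesis .
qed

section \<open>Classification of the irreducible modules\<close>

text \<open>
  The congruence defining \<open>\<Lambda>\<close> has an even modulus, so \<open>l - k\<close> is even. The two families of modules
  for a self-dual label are thus the two eigenspaces of \<open>reflect\<close>, in an order depending on \<open>l - k\<close>.
\<close>

lemma folding_sign:
  assumes "l \<in> \<Lambda> n k"
  shows "(\<i> powi (int l - int k)) * (\<i> powi (int l - int k)) = 1"
    and "\<i> powi (int l - int k) \<in> {1, - 1}"
proof -
  obtain a where "[int l = int k - 2 * int a] (mod 2 * int n)" using assms by (auto simp: \<Lambda>_def)
  then have "2 * int n dvd int l - (int k - 2 * int a)" by (simp add: cong_iff_dvd_diff)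
  then have "2 dvd int l - (int k - 2 * int a)" by (rule dvd_trans[OF dvd_triv_left])
  then have "even (int l - int k)" by presburger
  then show "(\<i> powi (int l - int k)) * (\<i> powi (int l - int k)) = 1"
    by (simp add: power_int_mult_distrib[symmetric] power_int_minus_left_even)
  then show "\<i> powi (int l - int k) \<in> {1, - 1}"
    by (simp add: square_eq_1_iff)
qed

text \<open>
  The residue of the weight in \<open>{0..<2 * n}\<close> is a label unless it exceeds \<open>n\<close>; flipping then replaces
  it by its negative.
\<close>

lemma label_of_weight:
  fixes \<iota> :: "'k::finite \<Rightarrow> 2"
  assumes "n > 0"
  shows "\<exists>l\<in>\<Lambda> n CARD('k). [weight \<iota> = int l] (mod 2 * int n) \<or> [weight (flip \<iota>) = int l] (mod 2 * int n)"
proof -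
  have mem: "l \<in> \<Lambda> n CARD('k)" if "l \<le> n" "[weight \<kappa> = int l] (mod 2 * int n)" for l and \<kappa> :: "'k \<Rightarrow> 2"
  proof -
    have "card {j. \<kappa> j = 1} \<le> CARD('k)" by (rule card_mono) simp_all
    then show ?thesis using that cong_sym by (fastforce simp: \<Lambda>_def weight_def)
  qed
  define m where "m = weight \<iota> mod (2 * int n)"
  have m: "0 \<le> m" "m < 2 * int n" "[weight \<iota> = m] (mod 2 * int n)"
    using assms by (simp_all add: m_def)
  show ?thesis
  proof (cases "m \<le> int n")
    case True
    then have "[weight \<iota> = int (nat m)] (mod 2 * int n)" "nat m \<le> n" using m by simp_all
    then show ?thesis using mem by blast
  next
    case False
    have "[- weight \<iota> = - m] (mod 2 * int n)" using m(3) by (simp add: cong_minus_minus_iff)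
    then have "[weight (flip \<iota>) = int (nat (2 * int n - m))] (mod 2 * int n)"
      using m(2) by (simp add: cong_def)
    moreover have "nat (2 * int n - m) \<le> n" using False by simp
    ultimately show ?thesis using mem by blast
  qed
qed

theorem theorem3p29:
  fixes n k :: nat and \<zeta> :: complex
    and Z :: "('k::{finite,linorder} tensor \<Rightarrow> 'k tensor) set"
  assumes "n \<ge> 2"
    and "k = CARD('k)"
    and "primitive_root_of_unity (2 * n) \<zeta>"
    and "Z = centralizer_algebra \<zeta>"
  shows
    "(\<forall>l \<in> \<Lambda> n k \<inter> {1..n-1}.
        irreducible_module Z (*s) (Zmod n l :: 'k tensor set) eval_action \<and>
        vec.dim (Zmod n l :: 'k tensor set) =
          (\<Sum>b | b \<le> k \<and> [b = a_min n k l] (mod n). k choose b) \<and>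
        of_nat (\<Sum>b | b \<le> k \<and> [b = a_min n k l] (mod n). k choose b) =
          cyclic_coeff n ([:1, 1:] ^ k) (a_min n k l)) \<and>
     (\<forall>l \<in> \<Lambda> n k \<inter> {0, n}.
        irreducible_module Z (*s) (Zmod_plus n l :: 'k tensor set) eval_action \<and>
        irreducible_module Z (*s) (Zmod_minus n l :: 'k tensor set) eval_action \<and>
        vec.dim (Zmod_minus n l :: 'k tensor set) = vec.dim (Zmod_plus n l :: 'k tensor set) \<and>
        real (vec.dim (Zmod_plus n l :: 'k tensor set)) =
          1 / 2 * real (\<Sum>b | b \<le> k \<and> [b = a_min n k l] (mod n). k choose b) \<and>
        1 / 2 * of_nat (\<Sum>b | b \<le> k \<and> [b = a_min n k l] (mod n). k choose b) =
          1 / 2 * cyclic_coeff n ([:1, 1:] ^ k) (a_min n k l)) \<and>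
     (\<forall>(sc :: complex \<Rightarrow> 'm::ab_group_add \<Rightarrow> 'm) U \<rho>. irreducible_module Z sc U \<rho> \<longrightarrow>
        (\<exists>l \<in> \<Lambda> n k \<inter> {1..n-1}.
           isomorphic_modules Z sc U \<rho> (*s) (Zmod n l :: 'k tensor set) eval_action) \<or>
        (\<exists>l \<in> \<Lambda> n k \<inter> {0, n}.
           isomorphic_modules Z sc U \<rho> (*s) (Zmod_plus n l :: 'k tensor set) eval_action \<or>
           isomorphic_modules Z sc U \<rho> (*s) (Zmod_minus n l :: 'k tensor set) eval_action))"
proof -
  have n: "n > 0" using assms(1) by simp
  note \<zeta> = assms(3) n
  let ?I = "\<lambda>l. module_index n l :: ('k \<Rightarrow> 2) set"
  let ?c = "\<lambda>l. \<i> powi (int l - int k)"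
  have coeff: "cyclic_coeff n ([:1, 1:] ^ k) (a_min n k l) =
      of_nat (\<Sum>b | b \<le> k \<and> [b = a_min n k l] (mod n). k choose b)" for l
    by (rule cyclic_coeff_binomial[OF n])
  have plus: "Zmod_plus n l = vec.span (folded_tensor (?c l) ` ?I l)"
    and minus: "Zmod_minus n l = vec.span (folded_tensor (- ?c l) ` ?I l)" for l
    unfolding assms(2) by (rule Zmod_plus_eq Zmod_minus_eq)+

  have weight_space: "irreducible_module Z (*s) (Zmod n l :: 'k tensor set) eval_action \<and>
      vec.dim (Zmod n l :: 'k tensor set) = (\<Sum>b | b \<le> k \<and> [b = a_min n k l] (mod n). k choose b)"
    if l: "l \<in> \<Lambda> n k" "l \<in> {1..n - 1}" for l
  proof -
    have I: "?I l = {\<iota>. [weight \<iota> = int l] (mod 2 * int n)}"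
      using l(2) by (auto simp: mem_module_index_iff)
    show ?thesis
      unfolding Zmod_eq assms(4)
      using irreducible_weight_space[OF \<zeta> I module_index_nonempty not_self_dual_label[OF l(2)]]
        card_weight_class[where 'k = 'k, of l n] l(1) I assms(2) by simp
  qed

  have folded: "irreducible_module Z (*s) (vec.span (folded_tensor \<epsilon> ` ?I l)) eval_action"
      "vec.dim (vec.span (folded_tensor \<epsilon> ` ?I l)) = card (?I l)"
    if l: "l \<in> \<Lambda> n k" "l \<in> {0, n}" and \<epsilon>: "\<epsilon> * \<epsilon> = 1" for l \<epsilon>
  proof -
    have I: "\<And>\<iota>. \<iota> \<in> ?I l \<Longrightarrow> [weight \<iota> = int l] (mod 2 * int n)" "?I l \<noteq> {}"
        "\<And>\<iota>. \<iota> \<in> ?I l \<Longrightarrow> flip \<iota> \<notin> ?I l"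
        "\<And>\<iota>. [weight \<iota> = int l] (mod 2 * int n) \<Longrightarrow> \<iota> \<in> ?I l \<or> flip \<iota> \<in> ?I l"
      using l flip_module_index_iff[OF l(2)] module_index_nonempty[where 'k = 'k, of l n] assms(2)
      by (auto simp: mem_module_index_iff)
    show "irreducible_module Z (*s) (vec.span (folded_tensor \<epsilon> ` ?I l)) eval_action"
      "vec.dim (vec.span (folded_tensor \<epsilon> ` ?I l)) = card (?I l)"
      unfolding assms(4) by (rule irreducible_folded_space[OF \<zeta> \<epsilon> I]; assumption)+
  qed

  have self_dual: "irreducible_module Z (*s) (Zmod_plus n l :: 'k tensor set) eval_action \<and>
      irreducible_module Z (*s) (Zmod_minus n l :: 'k tensor set) eval_action \<and>
      vec.dim (Zmod_minus n l :: 'k tensor set) = vec.dim (Zmod_plus n l :: 'k tensor set) \<and>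
      real (vec.dim (Zmod_plus n l :: 'k tensor set)) =
        1 / 2 * real (\<Sum>b | b \<le> k \<and> [b = a_min n k l] (mod n). k choose b)"
    if l: "l \<in> \<Lambda> n k" "l \<in> {0, n}" for l
  proof -
    have c: "?c l * ?c l = 1" "- ?c l * - ?c l = 1" using folding_sign(1)[OF l(1)] by simp_all
    have "2 * card (?I l) = (\<Sum>b | b \<le> k \<and> [b = a_min n k l] (mod n). k choose b)"
      using card_module_index_self_dual[where 'k = 'k, OF l(2)] card_weight_class[where 'k = 'k, of l n] l(1) assms(2)
      by simp
    then have "real (card (?I l)) = 1 / 2 * real (\<Sum>b | b \<le> k \<and> [b = a_min n k l] (mod n). k choose b)"
      by (metis (no_types, lifting) mult.assoc mult_1 nonzero_eq_divide_eq of_nat_mult of_nat_numeral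
          times_divide_eq_left zero_neq_numeral mult.commute)
    then show ?thesis
      unfolding plus minus using folded[OF l c(1)] folded[OF l c(2)] by simp
  qed

  have complete: "(\<exists>l \<in> \<Lambda> n k \<inter> {1..n-1}.
           isomorphic_modules Z sc U \<rho> (*s) (Zmod n l :: 'k tensor set) eval_action) \<or>
        (\<exists>l \<in> \<Lambda> n k \<inter> {0, n}.
           isomorphic_modules Z sc U \<rho> (*s) (Zmod_plus n l :: 'k tensor set) eval_action \<or>
           isomorphic_modules Z sc U \<rho> (*s) (Zmod_minus n l :: 'k tensor set) eval_action)"
    if irr: "irreducible_module Z sc U \<rho>" for sc :: "complex \<Rightarrow> 'm \<Rightarrow> 'm" and U \<rho>
  proof -
    have Z: "endomorphism_algebra Z" unfolding assms(4) by (rule endomorphism_algebra_centralizer)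
    have M: "algebra_module (centralizer_algebra \<zeta> :: ('k tensor \<Rightarrow> _) set) sc U \<rho>" and "U \<noteq> {0}"
      using irr unfolding irreducible_module_def assms(4) by blast+
    interpret vector_space sc by (rule algebra_moduleD(1)[OF M])
    obtain u where u: "u \<in> U" "u \<noteq> 0"
      using \<open>U \<noteq> {0}\<close> subspace_0[OF algebra_moduleD(2)[OF M]] by blast
    obtain \<kappa> :: "'k \<Rightarrow> 2" where \<kappa>: "\<rho> (orbit_unit \<kappa> \<kappa>) u \<noteq> 0"
      using orbit_unit_acts_nontrivially[OF \<zeta> M u] by blast
    \<comment> \<open>Replacing \<open>\<kappa>\<close> by \<open>flip \<kappa>\<close> does not change \<open>orbit_unit \<kappa> \<kappa>\<close>, so the weight may be normalised.\<close>
    obtain l where l: "l \<in> \<Lambda> n k"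
      and "[weight \<kappa> = int l] (mod 2 * int n) \<or> [weight (flip \<kappa>) = int l] (mod 2 * int n)"
      using label_of_weight[OF n, of \<kappa>] assms(2) by blast
    then obtain \<iota> where \<iota>: "[weight \<iota> = int l] (mod 2 * int n)" "\<rho> (orbit_unit \<iota> \<iota>) u \<noteq> 0"
      using \<kappa> orbit_unit_flip by metis
    show ?thesis
    proof (cases "l \<in> {0, n}")
      case False
      then have l': "l \<in> {1..n - 1}" using l by (auto simp: \<Lambda>_def)
      have w: "\<not> [weight \<iota> = - weight \<iota>] (mod 2 * int n)"
      proof
        assume "[weight \<iota> = - weight \<iota>] (mod 2 * int n)"
        moreover have "[- weight \<iota> = - int l] (mod 2 * int n)"
          using \<iota>(1) by (simp add: cong_minus_minus_iff)
        ultimately have "[int l = - int l] (mod 2 * int n)" using \<iota>(1) by (simp add: cong_def)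
        then show False using not_self_dual_label[OF l'] by blast
      qed
      have e: "orbit_unit \<iota> \<iota> \<in> Z"
        unfolding assms(4) by (rule orbit_unit_in_centralizer[OF \<zeta>]) simp
      have min: "\<forall>z\<in>Z. \<exists>c. orbit_unit \<iota> \<iota> \<circ> z \<circ> orbit_unit \<iota> \<iota> = (\<lambda>w. c *s orbit_unit \<iota> \<iota> w)"
        using minimal_orbit_unit[OF \<zeta> w] assms(4) by blast
      have "unit_tensor \<iota> \<in> Zmod n l"
        unfolding Zmod_eq using \<iota>(1) False
        by (intro vec.span_base imageI) (simp add: mem_module_index_iff)
      moreover have "eval_action (orbit_unit \<iota> \<iota>) (unit_tensor \<iota>) \<noteq> 0"
        by (simp add: eval_action_def orbit_unit_def axis_def vec_eq_iff)
      ultimately have "isomorphic_modules Z sc U \<rho> (*s) (Zmod n l :: 'k tensor set) eval_action"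
        by (intro isomorphic_by_minimal_idempotent[OF Z irr conjunct1[OF weight_space[OF l l']] e
              orbit_unit_diagonal_idempotent min u(1) \<iota>(2)])
      then show ?thesis using l l' by blast
    next
      case True
      have w: "[weight \<iota> = - weight \<iota>] (mod 2 * int n)"
      proof -
        have "[- weight \<iota> = - int l] (mod 2 * int n)"
          using \<iota>(1) by (simp add: cong_minus_minus_iff)
        then show ?thesis using \<iota>(1) self_dual_label[OF True] by (simp add: cong_def)
      qed
      obtain \<epsilon> where \<epsilon>: "\<epsilon> \<in> {1, - 1}" "\<rho> (folded_projection \<epsilon> \<iota>) u \<noteq> 0"
        using folded_projection_acts_nontrivially[OF \<zeta> M u(1) \<iota>(2) w] by blast
      then have sq: "\<epsilon> * \<epsilon> = 1" by auto
      \<comment> \<open>Only one of \<open>\<iota>\<close> and \<open>flip \<iota>\<close> is an index, but both define the same projection.\<close>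
      obtain \<mu> where \<mu>: "\<mu> \<in> ?I l" "\<rho> (folded_projection \<epsilon> \<mu>) u \<noteq> 0" "[weight \<mu> = - weight \<mu>] (mod 2 * int n)"
      proof (cases "\<iota> \<in> ?I l")
        case False
        then have "flip \<iota> \<in> ?I l" using flip_module_index_iff[OF True \<iota>(1)] by blast
        moreover have "[weight (flip \<iota>) = - weight (flip \<iota>)] (mod 2 * int n)" using w by (simp add: cong_sym)
        ultimately show ?thesis using that \<epsilon>(2) folded_projection_flip[OF sq, of \<iota>] by metis
      qed (use that \<epsilon>(2) w in blast)
      have e: "folded_projection \<epsilon> \<mu> \<in> Z"
        unfolding assms(4) by (rule folded_projection_in_centralizer[OF \<zeta> sq \<mu>(3)])
      have min: "\<forall>z\<in>Z. \<exists>c. folded_projection \<epsilon> \<mu> \<circ> z \<circ> folded_projection \<epsilon> \<mu> = (\<lambda>w. c *s folded_projection \<epsilon> \<mu> w)"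
        using minimal_folded_projection endomorphism_algebraD(5)[OF Z] by blast
      have "folded_tensor \<epsilon> \<mu> \<in> vec.span (folded_tensor \<epsilon> ` ?I l)"
        using \<mu>(1) by (intro vec.span_base imageI)
      moreover have "eval_action (folded_projection \<epsilon> \<mu>) (folded_tensor \<epsilon> \<mu>) \<noteq> 0"
        by (simp add: eval_action_def sq folded_tensor_nonzero)
      ultimately have iso: "isomorphic_modules Z sc U \<rho> (*s) (vec.span (folded_tensor \<epsilon> ` ?I l)) eval_action"
        by (intro isomorphic_by_minimal_idempotent[OF Z irr folded(1)[OF l True sq] e
              folded_projection_idempotent[OF sq] min u(1) \<mu>(2)])
      have "\<epsilon> = ?c l \<or> \<epsilon> = - ?c l" using folding_sign(2)[OF l] \<epsilon>(1) by auto
      then show ?thesis using iso plus minus l True by (metis IntI)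
    qed
  qed

  show ?thesis
    using weight_space self_dual complete coeff by simp
qed

end
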